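(* Let $0<s\le t<\infty$, and let $\{Z_1(t)\}_{t\ge0}$ be the time-changed compound Poisson process of order $k$, $Z_1(t)=Z(S(t))$, denoted $TCPPoK(\lambda,H,S_{\alpha_1,\alpha_2}^{\mu_1,\mu_2})$, where $S(t)=S_{\alpha_1,\alpha_2}^{\mu_1,\mu_2}(t)$; let $Y$ denote a random variable with distribution function $H$. Then the mean and covariance function of $\{Z_1(t)\}_{t\ge0}$ are given by: (i) $\mathbb{E}[Z_1(t)]=\frac{k(k+1)}{2}\,\lambda\,\mathbb{E}[Y]\,\mathbb{E}[S(t)]$; (ii) $\mathrm{Cov}[Z_1(s),Z_1(t)]=(\mathbb{E}[Z(1)])^2\,\mathrm{Var}[S(s)]+\mathbb{E}[S(s)]\,\mathrm{Var}[Z(1)]$.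
   Context: Fix an integer $k\ge1$ and $\lambda>0$. Poisson process of order $k$, $PPoK(\lambda)$: $N^{(k)}(t)=\sum_{i=1}^{N(t)}X_i$, where $\{N(t)\}_{t\ge0}$ is a Poisson process with rate $k\lambda$ and $\{X_i\}_{i\ge1}$ are i.i.d. discrete uniform on $\{1,\dots,k\}$, independent of $\{N(t)\}$. Compound Poisson process of order $k$, $CPPoK(\lambda,H)$: $Z(t)=\sum_{i=1}^{N^{(k)}(t)}Y_i$, where $\{N^{(k)}(t)\}_{t\ge0}$ is $PPoK(\lambda)$ and $\{Y_i\}_{i\ge1}$ are i.i.d. random variables with cumulative distribution function $H$, independent of $\{N^{(k)}(t)\}$. Mixture of tempered stable subordinators (MTSS): $\{S_{\alpha_1,\alpha_2}^{\mu_1,\mu_2}(t)\}_{t\ge0}$ is the Lévy subordinator (one-dimensional non-decreasing Lévy process) with $$\mathbb{E}[e^{-uS_{\alpha_1,\alpha_2}^{\mu_1,\mu_2}(t)}]=\exp\{-t(c_1((u+\mu_1)^{\alpha_1}-\mu_1^{\alpha_1})+c_2((u+\mu_2)^{\alpha_2}-\mu_2^{\alpha_2}))\},\quad u>0,$$ where $c_1,c_2\ge0$, $c_1+c_2=1$, $\mu_1,\mu_2>0$, $\alpha_1,\alpha_2\in(0,1)$. $TCPPoK(\lambda,H,S_{\alpha_1,\alpha_2}^{\mu_1,\mu_2})$: with $\mathbb{E}[S_{\alpha_1,\alpha_2}^{\mu_1,\mu_2}(t)^{\rho}]<\infty$ for all $\rho>0$, $Z_1(t)=Z(S_{\alpha_1,\alpha_2}^{\mu_1,\mu_2}(t))$,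 where $\{Z(t)\}_{t\ge0}$ is $CPPoK(\lambda,H)$, independent of $\{S_{\alpha_1,\alpha_2}^{\mu_1,\mu_2}(t)\}_{t\ge0}$. *)

theory Defs
  imports "HOL-Probability.Probability"
begin

context prob_space
begin

definition covariance :: "('a \<Rightarrow> real) \<Rightarrow> ('a \<Rightarrow> real) \<Rightarrow> real" where
  "covariance U V = expectation (\<lambda>\<omega>. (U \<omega> - expectation U) * (V \<omega> - expectation V))"

definition sigma_gen :: "'i set \<Rightarrow> 'b measure \<Rightarrow> ('i \<Rightarrow> 'a \<Rightarrow> 'b) \<Rightarrow> 'a set set" where
  "sigma_gen I N X = sigma_sets (space M) {X i -` A \<inter> space M | i A. i \<in> I \<and> A \<in> sets N}"

text \<open>Independence of two families of random variables, as families. The library's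
  \<^const>\<open>indep_var\<close> cannot be used, since it requires both variables to have the same value
  type.\<close>

definition indep_families ::
    "'i set \<Rightarrow> 'b measure \<Rightarrow> ('i \<Rightarrow> 'a \<Rightarrow> 'b) \<Rightarrow> 'j set \<Rightarrow> 'c measure \<Rightarrow> ('j \<Rightarrow> 'a \<Rightarrow> 'c) \<Rightarrow> bool" where
  "indep_families I N X J K Y \<longleftrightarrow> 
     (\<forall>i\<in>I. random_variable N (X i)) \<and> (\<forall>j\<in>J. random_variable K (Y j)) \<and>
     indep_set (sigma_gen I N X) (sigma_gen J K Y)"

text \<open>Processes are indexed by \<^typ>\<open>real\<close>, but only times in \<open>{0..}\<close> are relevant. Path
  properties are required of every sample path, not just of almost every one, so that
  \<open>Z (S t \<omega>) \<omega>\<close> is a random variable even if the probability space is not complete.\<close>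

definition levy_process :: "(real \<Rightarrow> 'a \<Rightarrow> real) \<Rightarrow> bool" where
  "levy_process X \<longleftrightarrow>
     (\<forall>t\<ge>0. random_variable borel (X t)) \<and>
     (AE \<omega> in M. X 0 \<omega> = 0) \<and>
     (\<forall>(n::nat) t. 0 \<le> t 0 \<and> (\<forall>i<n. t i \<le> t (Suc i)) \<longrightarrow>
        indep_vars (\<lambda>_. borel) (\<lambda>i \<omega>. X (t (Suc i)) \<omega> - X (t i) \<omega>) {..<n}) \<and>
     (\<forall>s\<ge>0. \<forall>h\<ge>0. distr M borel (\<lambda>\<omega>. X (s + h) \<omega> - X s \<omega>) = distr M borel (\<lambda>\<omega>. X h \<omega> - X 0 \<omega>)) \<and>
     (\<forall>t\<ge>0. \<forall>\<epsilon>>0. ((\<lambda>u. prob {\<omega> \<in> space M. \<bar>X u \<omega> - X t \<omega>\<bar> > \<epsilon>}) \<longlongrightarrow> 0) (at t within {0..})) \<and>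
     (\<forall>\<omega>\<in>space M. \<forall>t\<ge>0. continuous (at_right t) (\<lambda>u. X u \<omega>) \<and>
        (t > 0 \<longrightarrow> (\<exists>l. ((\<lambda>u. X u \<omega>) \<longlongrightarrow> l) (at_left t))))"

definition subordinator :: "(real \<Rightarrow> 'a \<Rightarrow> real) \<Rightarrow> bool" where
  "subordinator X \<longleftrightarrow> levy_process X \<and>
     (\<forall>\<omega>\<in>space M. (\<forall>t\<ge>0. 0 \<le> X t \<omega>) \<and> mono_on {0..} (\<lambda>t. X t \<omega>))"

definition poisson_process :: "real \<Rightarrow> (real \<Rightarrow> 'a \<Rightarrow> nat) \<Rightarrow> bool" where
  "poisson_process r N \<longleftrightarrow> levy_process (\<lambda>t \<omega>. real (N t \<omega>)) \<and>
     (\<forall>t>0. distr M (count_space UNIV) (N t) = measure_pmf (poisson_pmf (r * t)))"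

definition ppok :: "nat \<Rightarrow> real \<Rightarrow> (real \<Rightarrow> 'a \<Rightarrow> nat) \<Rightarrow> bool" where
  "ppok k lam Nk \<longleftrightarrow> (\<exists>(N :: real \<Rightarrow> 'a \<Rightarrow> nat) (X :: nat \<Rightarrow> 'a \<Rightarrow> nat).
     poisson_process (real k * lam) N \<and>
     indep_vars (\<lambda>_. count_space UNIV) X {1..} \<and>
     (\<forall>i\<ge>1. distr M (count_space UNIV) (X i) = measure_pmf (pmf_of_set {1..k})) \<and>
     indep_families {1..} (count_space UNIV) X {0..} (count_space UNIV) N \<and>
     (\<forall>t\<ge>0. \<forall>\<omega>\<in>space M. Nk t \<omega> = (\<Sum>i=1..N t \<omega>. X i \<omega>)))"

definition cppok :: "nat \<Rightarrow> real \<Rightarrow> (real \<Rightarrow> real) \<Rightarrow> (real \<Rightarrow> 'a \<Rightarrow> real) \<Rightarrow> bool" where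
  "cppok k lam H Z \<longleftrightarrow> (\<exists>(Nk :: real \<Rightarrow> 'a \<Rightarrow> nat) (Y :: nat \<Rightarrow> 'a \<Rightarrow> real).
     ppok k lam Nk \<and>
     indep_vars (\<lambda>_. borel) Y {1..} \<and>
     (\<forall>i\<ge>1. cdf (distr M borel (Y i)) = H) \<and>
     indep_families {1..} borel Y {0..} (count_space UNIV) Nk \<and>
     (\<forall>t\<ge>0. \<forall>\<omega>\<in>space M. Z t \<omega> = (\<Sum>i=1..Nk t \<omega>. Y i \<omega>)))"

definition mtss ::
    "real \<Rightarrow> real \<Rightarrow> real \<Rightarrow> real \<Rightarrow> real \<Rightarrow> real \<Rightarrow> (real \<Rightarrow> 'a \<Rightarrow> real) \<Rightarrow> bool" where
  "mtss c1 c2 \<alpha>1 \<alpha>2 \<mu>1 \<mu>2 S \<longleftrightarrow> subordinator S \<and>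
     (\<forall>t\<ge>0. \<forall>u>0. expectation (\<lambda>\<omega>. exp (- u * S t \<omega>)) =
        exp (- t * (c1 * ((u + \<mu>1) powr \<alpha>1 - \<mu>1 powr \<alpha>1) + c2 * ((u + \<mu>2) powr \<alpha>2 - \<mu>2 powr \<alpha>2))))"

definition tcppok ::
    "nat \<Rightarrow> real \<Rightarrow> (real \<Rightarrow> real) \<Rightarrow> real \<Rightarrow> real \<Rightarrow> real \<Rightarrow> real \<Rightarrow> real \<Rightarrow> real \<Rightarrow>
     (real \<Rightarrow> 'a \<Rightarrow> real) \<Rightarrow> (real \<Rightarrow> 'a \<Rightarrow> real) \<Rightarrow> (real \<Rightarrow> 'a \<Rightarrow> real) \<Rightarrow> bool" where
  "tcppok k lam H c1 c2 \<alpha>1 \<alpha>2 \<mu>1 \<mu>2 Z S Z1 \<longleftrightarrow>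
     cppok k lam H Z \<and>
     mtss c1 c2 \<alpha>1 \<alpha>2 \<mu>1 \<mu>2 S \<and>
     (\<forall>t\<ge>0. \<forall>\<rho>>0. integrable M (\<lambda>\<omega>. S t \<omega> powr \<rho>)) \<and>
     indep_families {0..} borel Z {0..} borel S \<and>
     (\<forall>t\<ge>0. \<forall>\<omega>\<in>space M. Z1 t \<omega> = Z (S t \<omega>) \<omega>)"

end

end

theory Submission
  imports Defs
begin

text \<open>
  A random sum \<open>R\<^sub>A = (\<Sum>i\<le>A. X i)\<close> of i.i.d. variables with mean \<open>\<mu>\<close> and variance \<open>v\<close>, with
  counting variables \<open>A\<close>, \<open>B\<close> independent of them, satisfies
  \<open>E (R\<^sub>A R\<^sub>B) = v E (min A B) + \<mu>\<^sup>2 E (A B)\<close>. Starting from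
  \<open>E (N x N y) = r x + r\<^sup>2 x y\<close> for \<open>x \<le> y\<close> for the Poisson process and applying this twice
  yields \<open>E (Z x Z y) = b x + m\<^sup>2 x y\<close> with \<open>m = E (Z 1)\<close> and \<open>b = Var (Z 1)\<close>, so the
  increments of \<open>Z\<close> never have to be studied. Conditioning on the independent subordinator
  gives \<open>E (Z1 s Z1 t) = b E (S s) + m\<^sup>2 E (S s S t)\<close>, and
  \<open>Cov (S s, S t) = Var (S s)\<close> because \<open>S\<close> has independent increments.
\<close>

section \<open>Index sums and Poisson moments\<close>

lemma abs_mult_le_sum_power2:
  fixes x y :: real
  shows "\<bar>x * y\<bar> \<le> x\<^sup>2 + y\<^sup>2"
  using sum_squares_bound[of x y] sum_squares_bound[of "- x" y] by (simp add: abs_le_iff)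

text \<open>The diagonal meets an \<open>n\<close> by \<open>m\<close> rectangle in
  \<open>min n m\<close> cells, and each of them differs from the constant
  \<open>\<mu>\<^sup>2\<close> by \<open>q - \<mu>\<^sup>2\<close>. The summand models the mixed
  second moments of uncorrelated variables with mean \<open>\<mu>\<close> and second moment
  \<open>q\<close>.\<close>

lemma sum_min_diagonal:
  fixes q \<mu> :: real
  shows "(\<Sum>i=1..n. \<Sum>j=1..m. if i = j then q else \<mu>\<^sup>2) =
    (q - \<mu>\<^sup>2) * real (min n m) + \<mu>\<^sup>2 * (real n * real m)"
proof -
  have "(\<Sum>j=1..m. if i = j then q else \<mu>\<^sup>2) =
      (if i \<in> {1..m} then q - \<mu>\<^sup>2 else 0) + \<mu>\<^sup>2 * real m" for i
  proof -
    have "(\<Sum>j=1..m. if i = j then q else \<mu>\<^sup>2) = (\<Sum>j=1..m. (if j = i then q - \<mu>\<^sup>2 else 0) + \<mu>\<^sup>2)"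
      by (intro sum.cong) auto
    then show ?thesis by (simp add: sum.distrib sum.delta)
  qed
  moreover have "(\<Sum>i=1..n. if i \<in> {1..m} then q - \<mu>\<^sup>2 else 0) = (q - \<mu>\<^sup>2) * real (min n m)"
  proof -
    have "{1..n} \<inter> {1..m} = {1..min n m}" by auto
    then show ?thesis by (simp only: sum.inter_restrict[symmetric] finite_atLeastAtMost) simp
  qed
  ultimately show ?thesis
    by (simp only: sum.distrib) simp
qed

text \<open>Factorial moments suit the Poisson weights: the factors cancel against the factorial and
  leave the exponential series shifted by one or two places. The sum of the two moments is the
  second moment.\<close>

lemma poisson_pmf_factorial_moments:
  assumes r: "r > 0"
  shows "has_bochner_integral (measure_pmf (poisson_pmf r)) real r"
    "has_bochner_integral (measure_pmf (poisson_pmf r)) (\<lambda>n. real n * (real n - 1)) (r\<^sup>2)"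
proof -
  \<comment> \<open>For nonnegative \<open>f\<close>, summability of the weighted series already
    gives integrability against counting measure, and the Poisson law has a density there.\<close>
  have *: "has_bochner_integral (measure_pmf (poisson_pmf r)) f x"
    if "(\<lambda>n. r ^ n / fact n * exp (- r) * f n) sums x" "\<And>n. f n \<ge> 0" for f :: "nat \<Rightarrow> real" and x
  proof -
    let ?h = "\<lambda>n. pmf (poisson_pmf r) n *\<^sub>R f n"
    have h: "?h sums x" using that(1) r by simp
    have "integrable (count_space UNIV) ?h"
      unfolding integrable_count_space_nat_iff
      using sums_summable[OF h] that(2) by (simp add: abs_mult)
    then have "has_bochner_integral (count_space UNIV) ?h x"
      using sums_unique[OF h] by (simp add: has_bochner_integral_iff integral_count_space_nat)
    then show ?thesis
      unfolding measure_pmf_eq_density by (intro has_bochner_integral_density) auto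
  qed
  have e: "(\<lambda>n. r ^ n / fact n) sums exp r"
    using exp_converges[of r] by (simp add: divide_inverse mult.commute)
  have exp_cancel: "c * exp (- r) * exp r = c" for c
    by (simp add: mult.assoc mult_exp_exp)
  have shift1: "r ^ Suc n / fact (Suc n) * exp (- r) * real (Suc n) = r * exp (- r) * (r ^ n / fact n)" for n
    by (simp add: divide_simps)
  have "(\<lambda>n. r ^ Suc n / fact (Suc n) * exp (- r) * real (Suc n)) sums r"
    using sums_mult[OF e, of "r * exp (- r)"] unfolding shift1 exp_cancel .
  then show "has_bochner_integral (measure_pmf (poisson_pmf r)) real r"
    by (intro *, subst (asm) sums_Suc_iff) simp_all
  have shift2: "r ^ Suc (Suc n) / fact (Suc (Suc n)) * exp (- r) * (real (Suc (Suc n)) * (real (Suc (Suc n)) - 1)) =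
      r\<^sup>2 * exp (- r) * (r ^ n / fact n)" for n
    by (simp add: divide_simps power2_eq_square)
  have "(\<lambda>n. r ^ Suc (Suc n) / fact (Suc (Suc n)) * exp (- r) * (real (Suc (Suc n)) * (real (Suc (Suc n)) - 1))) sums r\<^sup>2"
    using sums_mult[OF e, of "r\<^sup>2 * exp (- r)"] unfolding shift2 exp_cancel .
  \<comment> \<open>The two terms dropped by the shift, at 0 and 1, vanish because of the factor
    \<open>real n * (real n - 1)\<close>.\<close>
  then have "(\<lambda>n. r ^ n / fact n * exp (- r) * (real n * (real n - 1))) sums r\<^sup>2"
    by (subst (asm) sums_Suc_iff, subst (asm) sums_Suc_iff) simp_all
  moreover have "real n * (real n - 1) \<ge> 0" for n
    by (cases n) auto
  ultimately show "has_bochner_integral (measure_pmf (poisson_pmf r)) (\<lambda>n. real n * (real n - 1)) (r\<^sup>2)"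
    by (intro *)
qed

section \<open>Conditioning on an independent sigma-algebra\<close>

context prob_space
begin

text \<open>Conditioning on \<open>G\<close> freezes the first argument: the law of \<open>(\<omega>, \<omega>)\<close> on \<open>G \<Otimes>\<^sub>M F\<close> is a product.\<close>

lemma indep_set_Fubini:
  fixes f :: "'a \<Rightarrow> 'a \<Rightarrow> real"
  assumes F: "subalgebra M F" and G: "subalgebra M G"
    and indep: "indep_set (sets F) (sets G)"
    and f: "case_prod f \<in> borel_measurable (G \<Otimes>\<^sub>M F)"
    and int: "\<And>x. x \<in> space M \<Longrightarrow> integrable M (f x)"
    and bound: "\<And>x. x \<in> space M \<Longrightarrow> expectation (\<lambda>\<omega>. \<bar>f x \<omega>\<bar>) \<le> h x"
    and h: "integrable M h"
    and g: "\<And>x. x \<in> space M \<Longrightarrow> expectation (f x) = g x"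
  shows "integrable M (\<lambda>\<omega>. f \<omega> \<omega>)" "expectation (\<lambda>\<omega>. f \<omega> \<omega>) = expectation g"
proof -
  \<comment> \<open>\<open>P\<close> and \<open>Q\<close> are \<open>M\<close> restricted to
    \<open>F\<close> and \<open>G\<close>, so their product lives on the sigma-algebra for which
    \<open>f\<close> is measurable.\<close>
  define P where "P = restr_to_subalg M F"
  define Q where "Q = restr_to_subalg M G"
  have sets_P [measurable_cong]: "sets P = sets F" and sets_Q [measurable_cong]: "sets Q = sets G"
    unfolding P_def Q_def by (simp_all add: sets_restr_to_subalg F G)
  have space_Q: "space Q = space M" by (simp add: Q_def space_restr_to_subalg)
  have space_G: "space G = space M" using G by (simp add: subalgebra_def)
  interpret P: prob_space P
    unfolding P_def by (rule prob_space_restr_to_subalg[OF F]) (rule prob_space_axioms)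
  interpret Q: prob_space Q
    unfolding Q_def by (rule prob_space_restr_to_subalg[OF G]) (rule prob_space_axioms)
  interpret pair_sigma_finite Q P ..
  have diag [measurable]: "(\<lambda>\<omega>. (\<omega>, \<omega>)) \<in> M \<rightarrow>\<^sub>M G \<Otimes>\<^sub>M F"
    by (intro measurable_Pair measurable_from_subalg[OF F] measurable_from_subalg[OF G]) simp_all
  have f' [measurable]: "case_prod f \<in> borel_measurable (Q \<Otimes>\<^sub>M P)"
    using f by (simp cong: measurable_cong_sets sets_pair_measure_cong add: sets_P sets_Q)
  have f_F: "f x \<in> borel_measurable F" if "x \<in> space M" for x
    using measurable_Pair2[OF f, of x] that by (simp add: space_G)
  \<comment> \<open>Rectangles determine the measure. The diagonal pulls \<open>A \<times> B\<close>
    back to an intersection of an event of \<open>G\<close> with an event of \<open>F\<close>, whose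
    probability factors by independence.\<close>
  have eq: "Q \<Otimes>\<^sub>M P = distr M (G \<Otimes>\<^sub>M F) (\<lambda>\<omega>. (\<omega>, \<omega>))"
  proof (rule pair_measure_eqI)
    show "sigma_finite_measure Q" "sigma_finite_measure P" by unfold_locales
    show "sets (Q \<Otimes>\<^sub>M P) = sets (distr M (G \<Otimes>\<^sub>M F) (\<lambda>\<omega>. (\<omega>, \<omega>)))"
      by (simp cong: sets_pair_measure_cong add: sets_P sets_Q)
    fix A B assume A: "A \<in> sets Q" and B: "B \<in> sets P"
    then have AG: "A \<in> sets G" and BF: "B \<in> sets F" by (simp_all add: sets_P sets_Q)
    then have AB: "A \<in> events" "B \<in> events" using F G by (auto simp: subalgebra_def)
    have "emeasure Q A * emeasure P B = emeasure M A * emeasure M B"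
      unfolding P_def Q_def using AG BF F G by (simp add: emeasure_restr_to_subalg)
    also have "\<dots> = emeasure M (B \<inter> A)"
      using indep_setD[OF indep BF AG]
      by (simp add: emeasure_eq_measure ennreal_mult'' mult.commute)
    also have "B \<inter> A = (\<lambda>\<omega>. (\<omega>, \<omega>)) -` (A \<times> B) \<inter> space M"
      using sets.sets_into_space[OF AB(1)] by auto
    also have "emeasure M \<dots> = emeasure (distr M (G \<Otimes>\<^sub>M F) (\<lambda>\<omega>. (\<omega>, \<omega>))) (A \<times> B)"
      using AG BF by (subst emeasure_distr) auto
    finally show "emeasure Q A * emeasure P B = emeasure (distr M (G \<Otimes>\<^sub>M F) (\<lambda>\<omega>. (\<omega>, \<omega>))) (A \<times> B)" .
  qed
  have P_int: "integrable P (f x)" if "x \<in> space M" for x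
    unfolding P_def using integrable_in_subalg[OF F f_F[OF that] int[OF that]] .
  have P_lint: "(\<integral>y. f x y \<partial>P) = g x" if "x \<in> space M" for x
    unfolding P_def using integral_subalgebra2[OF F f_F[OF that]] g[OF that] by simp
  have P_abs: "(\<integral>y. norm (f x y) \<partial>P) \<le> h x" if "x \<in> space M" for x
  proof -
    have "(\<lambda>y. norm (f x y)) \<in> borel_measurable F" using f_F[OF that] by measurable
    from integral_subalgebra2[OF F this] bound[OF that] show ?thesis unfolding P_def by simp
  qed
  \<comment> \<open>Fubini needs the inner integral of the norm to be integrable over
    \<open>Q\<close>. Domination by \<open>h\<close> takes place over \<open>M\<close>, so
    integrability is shown there first and then restricted to \<open>G\<close>.\<close>
  have norm_Q: "(\<lambda>x. \<integral>y. norm (f x y) \<partial>P) \<in> borel_measurable Q"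
    by measurable
  have "integrable M (\<lambda>x. \<integral>y. norm (f x y) \<partial>P)"
  proof (rule Bochner_Integration.integrable_bound[OF h])
    show "(\<lambda>x. \<integral>y. norm (f x y) \<partial>P) \<in> borel_measurable M"
      using norm_Q by (intro measurable_from_subalg[OF G]) (simp add: measurable_cong_sets[OF sets_Q])
    show "AE x in M. norm (\<integral>y. norm (f x y) \<partial>P) \<le> norm (h x)"
      using P_abs by (intro AE_I2) (auto intro: order_trans[OF _ abs_ge_self])
  qed
  then have "integrable Q (\<lambda>x. \<integral>y. norm (f x y) \<partial>P)"
    unfolding Q_def using norm_Q
    by (intro integrable_in_subalg[OF G]) (simp_all add: measurable_cong_sets[OF sets_Q])
  then have QP: "integrable (Q \<Otimes>\<^sub>M P) (case_prod f)"
    using P_int by (intro Fubini_integrable f') (auto simp: space_Q)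
  then show "integrable M (\<lambda>\<omega>. f \<omega> \<omega>)"
    unfolding eq by (subst (asm) integrable_distr_eq[OF diag f]) simp
  \<comment> \<open>\<open>g\<close> inherits measurability for \<open>G\<close> from the inner
    integral, with which it agrees on the whole space.\<close>
  have g_G: "g \<in> borel_measurable G"
  proof -
    have "(\<lambda>x. \<integral>y. f x y \<partial>P) \<in> borel_measurable Q" by measurable
    then have "g \<in> borel_measurable Q"
      by (rule measurable_cong[THEN iffD1, rotated]) (simp add: space_Q P_lint)
    then show ?thesis by (simp add: measurable_cong_sets[OF sets_Q])
  qed
  have "expectation (\<lambda>\<omega>. f \<omega> \<omega>) = integral\<^sup>L (Q \<Otimes>\<^sub>M P) (case_prod f)"
    unfolding eq by (subst integral_distr[OF diag f]) simp
  also have "\<dots> = (\<integral>x. (\<integral>y. f x y \<partial>P) \<partial>Q)"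
    using integral_fst'[OF QP] by simp
  also have "\<dots> = (\<integral>x. g x \<partial>Q)"
    by (rule Bochner_Integration.integral_cong) (simp_all add: space_Q P_lint)
  also have "\<dots> = expectation g"
    unfolding Q_def by (rule integral_subalgebra2[OF G g_G])
  finally show "expectation (\<lambda>\<omega>. f \<omega> \<omega>) = expectation g" .
qed

section \<open>Random sums\<close>

text \<open>The count takes countably many values, and for each fixed value the expression is a
  finite sum of measurable functions of the second coordinate.\<close>

lemma random_sum_measurable:
  fixes X :: "nat \<Rightarrow> 'a \<Rightarrow> real"
  assumes "\<And>i. i \<ge> 1 \<Longrightarrow> X i \<in> borel_measurable F" and A: "A \<in> G \<rightarrow>\<^sub>M count_space UNIV"
  shows "(\<lambda>(\<omega>', \<omega>). \<Sum>i=1..A \<omega>'. X i \<omega>) \<in> borel_measurable (G \<Otimes>\<^sub>M F)"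
proof -
  have "(\<lambda>p. \<Sum>i=1..n. X i (snd p)) \<in> borel_measurable (G \<Otimes>\<^sub>M F)" for n
    using assms(1) by (intro borel_measurable_sum measurable_compose[OF measurable_snd]) auto
  moreover have "(\<lambda>p. A (fst p)) \<in> G \<Otimes>\<^sub>M F \<rightarrow>\<^sub>M count_space UNIV"
    by (rule measurable_compose[OF measurable_fst A])
  ultimately have "(\<lambda>p. \<Sum>i=1..A (fst p). X i (snd p)) \<in> borel_measurable (G \<Otimes>\<^sub>M F)"
    by (rule measurable_compose_countable)
  then show ?thesis by (simp add: case_prod_beta)
qed

text \<open>Wald's identity: with the count frozen at \<open>n\<close>, the sum has mean
  \<open>\<mu> * n\<close> and absolute mean at most \<open>\<nu> * n\<close>. The third claim later
  supplies the dominating function when a random sum is evaluated at a random time.\<close>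

lemma random_sum_mean:
  fixes X :: "nat \<Rightarrow> 'a \<Rightarrow> real"
  assumes F: "subalgebra M F" and G: "subalgebra M G"
    and indep: "indep_set (sets F) (sets G)"
    and X: "\<And>i. i \<ge> 1 \<Longrightarrow> X i \<in> borel_measurable F"
    and A: "A \<in> G \<rightarrow>\<^sub>M count_space UNIV"
    and X_int: "\<And>i. i \<ge> 1 \<Longrightarrow> integrable M (X i)"
    and X_mean: "\<And>i. i \<ge> 1 \<Longrightarrow> expectation (X i) = \<mu>"
    and X_abs: "\<And>i. i \<ge> 1 \<Longrightarrow> expectation (\<lambda>\<omega>. \<bar>X i \<omega>\<bar>) \<le> \<nu>"
    and A_int: "integrable M (\<lambda>\<omega>. real (A \<omega>))"
  shows "integrable M (\<lambda>\<omega>. \<Sum>i=1..A \<omega>. X i \<omega>)"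
    "expectation (\<lambda>\<omega>. \<Sum>i=1..A \<omega>. X i \<omega>) = \<mu> * expectation (\<lambda>\<omega>. real (A \<omega>))"
    "expectation (\<lambda>\<omega>. \<bar>\<Sum>i=1..A \<omega>. X i \<omega>\<bar>) \<le> \<nu> * expectation (\<lambda>\<omega>. real (A \<omega>))"
proof -
  note * = indep_set_Fubini[OF F G indep random_sum_measurable[of X F A G, OF X A],
    where h="\<lambda>\<omega>. \<nu> * real (A \<omega>)" and g="\<lambda>\<omega>. \<mu> * real (A \<omega>)"]
  have abs: "expectation (\<lambda>\<omega>. \<bar>\<Sum>i=1..n. X i \<omega>\<bar>) \<le> \<nu> * real n" for n
  proof -
    have "expectation (\<lambda>\<omega>. \<bar>\<Sum>i=1..n. X i \<omega>\<bar>) \<le> expectation (\<lambda>\<omega>. \<Sum>i=1..n. \<bar>X i \<omega>\<bar>)"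
      by (intro integral_mono integrable_abs Bochner_Integration.integrable_sum X_int sum_abs) auto
    also have "\<dots> = (\<Sum>i=1..n. expectation (\<lambda>\<omega>. \<bar>X i \<omega>\<bar>))"
      by (intro Bochner_Integration.integral_sum integrable_abs X_int) auto
    also have "\<dots> \<le> (\<Sum>i=1..n. \<nu>)"
      by (intro sum_mono X_abs) auto
    finally show ?thesis by (simp add: mult.commute)
  qed
  have mean: "expectation (\<lambda>\<omega>. \<Sum>i=1..n. X i \<omega>) = \<mu> * real n" for n
    by (subst Bochner_Integration.integral_sum) (auto simp: X_int X_mean)
  show int: "integrable M (\<lambda>\<omega>. \<Sum>i=1..A \<omega>. X i \<omega>)"
    by (rule *) (auto intro!: Bochner_Integration.integrable_sum X_int abs mean A_int simp del: One_nat_def)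
  show "expectation (\<lambda>\<omega>. \<Sum>i=1..A \<omega>. X i \<omega>) = \<mu> * expectation (\<lambda>\<omega>. real (A \<omega>))"
    by (subst *(2)) (auto intro!: Bochner_Integration.integrable_sum X_int abs mean A_int simp del: One_nat_def)
  have "case_prod (\<lambda>\<omega>' \<omega>. \<bar>\<Sum>i=1..A \<omega>'. X i \<omega>\<bar>) \<in> borel_measurable (G \<Otimes>\<^sub>M F)"
    using borel_measurable_abs[OF random_sum_measurable[of X F A G, OF X A]]
    by (simp add: case_prod_beta)
  \<comment> \<open>Choosing \<open>g\<close> as the inner expectation itself makes the premise on
    \<open>g\<close> trivial; it is compared with \<open>\<nu> * real (A \<omega>)\<close>
    afterwards.\<close>
  note ** = indep_set_Fubini[OF F G indep this,
    where h="\<lambda>\<omega>. \<nu> * real (A \<omega>)" and g="\<lambda>\<omega>'. expectation (\<lambda>\<omega>. \<bar>\<Sum>i=1..A \<omega>'. X i \<omega>\<bar>)"]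
  have "expectation (\<lambda>\<omega>. \<bar>\<Sum>i=1..A \<omega>. X i \<omega>\<bar>) =
      expectation (\<lambda>\<omega>'. expectation (\<lambda>\<omega>. \<bar>\<Sum>i=1..A \<omega>'. X i \<omega>\<bar>))"
    by (rule **) (auto intro!: Bochner_Integration.integrable_sum X_int abs A_int simp del: One_nat_def)
  also have "\<dots> \<le> expectation (\<lambda>\<omega>. \<nu> * real (A \<omega>))"
  proof (rule integral_mono)
    \<comment> \<open>The inner expectation depends on the outer point only through the count, and
      every function on a discrete space is measurable.\<close>
    have "A \<in> M \<rightarrow>\<^sub>M count_space UNIV" using measurable_from_subalg[OF G A] .
    then have "(\<lambda>\<omega>'. expectation (\<lambda>\<omega>. \<bar>\<Sum>i=1..A \<omega>'. X i \<omega>\<bar>)) \<in> borel_measurable M"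
      by (rule measurable_compose) simp
    then show "integrable M (\<lambda>\<omega>'. expectation (\<lambda>\<omega>. \<bar>\<Sum>i=1..A \<omega>'. X i \<omega>\<bar>))"
      by (rule Bochner_Integration.integrable_bound[where f="\<lambda>\<omega>. \<nu> * real (A \<omega>)", rotated])
        (auto intro!: A_int AE_I2 order_trans[OF abs abs_ge_self] simp del: One_nat_def)
  qed (auto intro!: abs A_int simp del: One_nat_def)
  finally show "expectation (\<lambda>\<omega>. \<bar>\<Sum>i=1..A \<omega>. X i \<omega>\<bar>) \<le> \<nu> * expectation (\<lambda>\<omega>. real (A \<omega>))"
    by simp
qed

text \<open>Both counts are measurable for \<open>G\<close>, so a single conditioning freezes them
  at \<open>n\<close> and \<open>m\<close>. The expanded double sum then has only two kinds of
  entries. The minimum covers either order of the counts.\<close>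

lemma random_sum_product:
  fixes X :: "nat \<Rightarrow> 'a \<Rightarrow> real"
  assumes F: "subalgebra M F" and G: "subalgebra M G"
    and indep: "indep_set (sets F) (sets G)"
    and X: "\<And>i. i \<ge> 1 \<Longrightarrow> X i \<in> borel_measurable F"
    and A: "A \<in> G \<rightarrow>\<^sub>M count_space UNIV" and B: "B \<in> G \<rightarrow>\<^sub>M count_space UNIV"
    and X_sq: "\<And>i. i \<ge> 1 \<Longrightarrow> integrable M (\<lambda>\<omega>. (X i \<omega>)\<^sup>2)"
    and X_sq_mean: "\<And>i. i \<ge> 1 \<Longrightarrow> expectation (\<lambda>\<omega>. (X i \<omega>)\<^sup>2) = q"
    and X_uncorr: "\<And>i j. i \<ge> 1 \<Longrightarrow> j \<ge> 1 \<Longrightarrow> i \<noteq> j \<Longrightarrow> expectation (\<lambda>\<omega>. X i \<omega> * X j \<omega>) = \<mu>\<^sup>2"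
    and A_sq: "integrable M (\<lambda>\<omega>. (real (A \<omega>))\<^sup>2)" and B_sq: "integrable M (\<lambda>\<omega>. (real (B \<omega>))\<^sup>2)"
  shows "integrable M (\<lambda>\<omega>. (\<Sum>i=1..A \<omega>. X i \<omega>) * (\<Sum>i=1..B \<omega>. X i \<omega>))"
    "expectation (\<lambda>\<omega>. (\<Sum>i=1..A \<omega>. X i \<omega>) * (\<Sum>i=1..B \<omega>. X i \<omega>)) =
      (q - \<mu>\<^sup>2) * expectation (\<lambda>\<omega>. real (min (A \<omega>) (B \<omega>))) + \<mu>\<^sup>2 * expectation (\<lambda>\<omega>. real (A \<omega>) * real (B \<omega>))"
proof -
  have A_M [measurable]: "A \<in> M \<rightarrow>\<^sub>M count_space UNIV" using measurable_from_subalg[OF G A] .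
  have B_M [measurable]: "B \<in> M \<rightarrow>\<^sub>M count_space UNIV" using measurable_from_subalg[OF G B] .
  have X_M: "X i \<in> borel_measurable M" if "i \<ge> 1" for i
    using measurable_from_subalg[OF F X[OF that]] .
  have XX: "integrable M (\<lambda>\<omega>. X i \<omega> * X j \<omega>)" if "i \<ge> 1" "j \<ge> 1" for i j
    using that by (intro Bochner_Integration.integrable_bound[OF Bochner_Integration.integrable_add[OF X_sq[of i] X_sq[of j]]])
      (auto intro!: borel_measurable_times X_M order_trans[OF abs_mult_le_sum_power2])
  \<comment> \<open>The constant is crude: \<open>2 * q\<close> is the mean of the sum of the two
    squares. It only has to yield a dominating function.\<close>
  have XX_abs: "expectation (\<lambda>\<omega>. \<bar>X i \<omega> * X j \<omega>\<bar>) \<le> 2 * q" if "i \<ge> 1" "j \<ge> 1" for i j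
  proof -
    have "expectation (\<lambda>\<omega>. \<bar>X i \<omega> * X j \<omega>\<bar>) \<le> expectation (\<lambda>\<omega>. (X i \<omega>)\<^sup>2 + (X j \<omega>)\<^sup>2)"
      using that by (intro integral_mono integrable_abs XX Bochner_Integration.integrable_add X_sq abs_mult_le_sum_power2)
    then show ?thesis using that by (simp add: X_sq X_sq_mean)
  qed
  have AB: "integrable M (\<lambda>\<omega>. real (A \<omega>) * real (B \<omega>))"
    by (rule Bochner_Integration.integrable_bound[OF Bochner_Integration.integrable_add[OF A_sq B_sq]])
      (auto intro!: AE_I2 order_trans[OF abs_ge_self abs_mult_le_sum_power2])
  have A_int: "integrable M (\<lambda>\<omega>. real (A \<omega>))"
    using A_sq by (rule square_integrable_imp_integrable[rotated]) simp
  have min_int: "integrable M (\<lambda>\<omega>. real (min (A \<omega>) (B \<omega>)))"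
    by (rule Bochner_Integration.integrable_bound[OF A_int]) auto
  let ?f = "\<lambda>\<omega>' \<omega>. (\<Sum>i=1..A \<omega>'. X i \<omega>) * (\<Sum>i=1..B \<omega>'. X i \<omega>)"
  let ?g = "\<lambda>\<omega>. (q - \<mu>\<^sup>2) * real (min (A \<omega>) (B \<omega>)) + \<mu>\<^sup>2 * (real (A \<omega>) * real (B \<omega>))"
  have meas: "case_prod ?f \<in> borel_measurable (G \<Otimes>\<^sub>M F)"
    using borel_measurable_times[OF random_sum_measurable[of X F A G, OF X A] random_sum_measurable[of X F B G, OF X B]]
    by (simp add: case_prod_beta)
  have int: "integrable M (\<lambda>\<omega>. (\<Sum>i=1..n. X i \<omega>) * (\<Sum>i=1..m. X i \<omega>))" for n m
    unfolding sum_product by (intro Bochner_Integration.integrable_sum XX) auto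
  have abs: "expectation (\<lambda>\<omega>. \<bar>(\<Sum>i=1..n. X i \<omega>) * (\<Sum>i=1..m. X i \<omega>)\<bar>) \<le> 2 * q * (real n * real m)" for n m
  proof -
    have "expectation (\<lambda>\<omega>. \<bar>(\<Sum>i=1..n. X i \<omega>) * (\<Sum>i=1..m. X i \<omega>)\<bar>)
        \<le> expectation (\<lambda>\<omega>. \<Sum>i=1..n. \<Sum>j=1..m. \<bar>X i \<omega> * X j \<omega>\<bar>)"
      using int unfolding sum_product
      by (intro integral_mono integrable_abs Bochner_Integration.integrable_sum XX)
        (auto intro!: order_trans[OF sum_abs] sum_mono)
    also have "\<dots> = (\<Sum>i=1..n. \<Sum>j=1..m. expectation (\<lambda>\<omega>. \<bar>X i \<omega> * X j \<omega>\<bar>))"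
      by (subst Bochner_Integration.integral_sum, (intro Bochner_Integration.integrable_sum integrable_abs XX; auto), intro sum.cong refl
         Bochner_Integration.integral_sum integrable_abs XX) auto
    also have "\<dots> \<le> (\<Sum>i=1..n. \<Sum>j=1..m. 2 * q)"
      by (intro sum_mono XX_abs) auto
    finally show ?thesis by (simp add: mult_ac)
  qed
  have mean: "expectation (\<lambda>\<omega>. (\<Sum>i=1..n. X i \<omega>) * (\<Sum>i=1..m. X i \<omega>)) =
      (q - \<mu>\<^sup>2) * real (min n m) + \<mu>\<^sup>2 * (real n * real m)" for n m
  proof -
    have "expectation (\<lambda>\<omega>. (\<Sum>i=1..n. X i \<omega>) * (\<Sum>i=1..m. X i \<omega>)) =
        (\<Sum>i=1..n. \<Sum>j=1..m. expectation (\<lambda>\<omega>. X i \<omega> * X j \<omega>))"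
      unfolding sum_product
      by (subst Bochner_Integration.integral_sum, (intro Bochner_Integration.integrable_sum XX; auto), intro sum.cong refl
         Bochner_Integration.integral_sum XX) auto
    also have "\<dots> = (\<Sum>i=1..n. \<Sum>j=1..m. if i = j then q else \<mu>\<^sup>2)"
      by (intro sum.cong refl) (auto simp: X_uncorr X_sq_mean power2_eq_square[symmetric])
    finally show ?thesis by (simp only: sum_min_diagonal)
  qed
  note * = indep_set_Fubini[OF F G indep meas, where g="?g" and h="\<lambda>\<omega>. 2 * q * (real (A \<omega>) * real (B \<omega>))", OF int abs _ mean]
  show "integrable M (\<lambda>\<omega>. ?f \<omega> \<omega>)" using * AB by simp
  show "expectation (\<lambda>\<omega>. ?f \<omega> \<omega>) =
      (q - \<mu>\<^sup>2) * expectation (\<lambda>\<omega>. real (min (A \<omega>) (B \<omega>))) + \<mu>\<^sup>2 * expectation (\<lambda>\<omega>. real (A \<omega>) * real (B \<omega>))"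
    using *(2) AB min_int by simp
qed

section \<open>Independent families as independent subalgebras\<close>

text \<open>\<open>sigma_gen\<close> is a bare set of sets; packaging it as a measure makes
  \<open>subalgebra\<close> and measurability statements available for it.\<close>

lemma sigma_gen_subalgebra:
  assumes X: "\<forall>i\<in>I. random_variable N (X i)"
  obtains F where "subalgebra M F" "sets F = sigma_gen I N X" "\<forall>i\<in>I. X i \<in> F \<rightarrow>\<^sub>M N"
proof
  let ?E = "{X i -` A \<inter> space M | i A. i \<in> I \<and> A \<in> sets N}"
  let ?F = "sigma (space M) ?E"
  have E: "?E \<subseteq> events" using X by (auto intro: measurable_sets)
  have "?E \<subseteq> Pow (space M)" by auto
  then show F: "sets ?F = sigma_gen I N X"
    by (simp add: sigma_gen_def)
  have "sigma_gen I N X \<subseteq> events"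
    unfolding sigma_gen_def by (rule sets.sigma_sets_subset[OF E])
  with F show "subalgebra M ?F"
    by (simp add: subalgebra_def space_measure_of_conv)
  show "\<forall>i\<in>I. X i \<in> ?F \<rightarrow>\<^sub>M N"
  proof (intro ballI measurableI)
    fix i A assume "i \<in> I" "A \<in> sets N"
    then show "X i -` A \<inter> space ?F \<in> sets ?F"
      unfolding F by (auto simp: sigma_gen_def space_measure_of_conv)
  qed (use X in \<open>auto simp: space_measure_of_conv dest: measurable_space\<close>)
qed

text \<open>Brings independence of families into the form required by
  \<open>indep_set_Fubini\<close>.\<close>

lemma indep_families_subalgebras:
  assumes "indep_families I N X J K Y"
  obtains F G where "subalgebra M F" "subalgebra M G" "indep_set (sets F) (sets G)"
    "\<And>i. i \<in> I \<Longrightarrow> X i \<in> F \<rightarrow>\<^sub>M N" "\<And>j. j \<in> J \<Longrightarrow> Y j \<in> G \<rightarrow>\<^sub>M K"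
proof -
  have XY: "\<forall>i\<in>I. random_variable N (X i)" "\<forall>j\<in>J. random_variable K (Y j)"
    and ind: "indep_set (sigma_gen I N X) (sigma_gen J K Y)"
    using assms by (auto simp: indep_families_def)
  obtain F where F: "subalgebra M F" "sets F = sigma_gen I N X" "\<forall>i\<in>I. X i \<in> F \<rightarrow>\<^sub>M N"
    using sigma_gen_subalgebra[OF XY(1)] .
  obtain G where G: "subalgebra M G" "sets G = sigma_gen J K Y" "\<forall>j\<in>J. Y j \<in> G \<rightarrow>\<^sub>M K"
    using sigma_gen_subalgebra[OF XY(2)] .
  show thesis
    by (rule that[OF F(1) G(1)]) (use F G ind in auto)
qed

lemma indep_vars_mult:
  fixes X :: "'i \<Rightarrow> 'a \<Rightarrow> real"
  assumes "indep_vars (\<lambda>_. borel) X I" "i \<in> I" "j \<in> I" "i \<noteq> j" "integrable M (X i)" "integrable M (X j)"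
  shows "integrable M (\<lambda>\<omega>. X i \<omega> * X j \<omega>)"
    "expectation (\<lambda>\<omega>. X i \<omega> * X j \<omega>) = expectation (X i) * expectation (X j)"
proof -
  have "indep_vars (\<lambda>_. borel) X {i, j}"
    using assms by (intro indep_vars_subset[OF assms(1)]) auto
  moreover have "integrable M (X l)" if "l \<in> {i, j}" for l using that assms by auto
  ultimately show "integrable M (\<lambda>\<omega>. X i \<omega> * X j \<omega>)"
    "expectation (\<lambda>\<omega>. X i \<omega> * X j \<omega>) = expectation (X i) * expectation (X j)"
    using indep_vars_integrable[of "{i, j}" X] indep_vars_lebesgue_integral[of "{i, j}" X] assms(4)
    by simp_all
qed

section \<open>Levy and Poisson processes\<close>

lemma levy_process_measurable: "levy_process X \<Longrightarrow> t \<ge> 0 \<Longrightarrow> X t \<in> borel_measurable M"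
  by (simp add: levy_process_def)

lemma levy_process_0: "levy_process X \<Longrightarrow> AE \<omega> in M. X 0 \<omega> = 0"
  by (simp add: levy_process_def)

text \<open>Split \<open>X x * X y\<close> into \<open>(X x)\<^sup>2\<close> and
  \<open>X x * (X y - X x)\<close>; in the second product the increment is independent of
  \<open>X x - X 0\<close>, which almost surely equals \<open>X x\<close>.\<close>

lemma levy_process_product:
  assumes X: "levy_process X" and xy: "0 \<le> x" "x \<le> y"
    and sq: "\<And>u. u \<ge> 0 \<Longrightarrow> integrable M (\<lambda>\<omega>. (X u \<omega>)\<^sup>2)"
  shows "integrable M (\<lambda>\<omega>. X x \<omega> * X y \<omega>)"
    "expectation (\<lambda>\<omega>. X x \<omega> * X y \<omega>) =
      expectation (\<lambda>\<omega>. (X x \<omega>)\<^sup>2) + expectation (X x) * (expectation (X y) - expectation (X x))"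
proof -
  have y: "y \<ge> 0" using xy by simp
  note [measurable] = levy_process_measurable[OF X xy(1)] levy_process_measurable[OF X y] levy_process_measurable[OF X order.refl]
  have int: "integrable M (X u)" if "u \<ge> 0" for u
    using levy_process_measurable[OF X that] sq[OF that] by (rule square_integrable_imp_integrable)
  note [simp] = int[OF xy(1)] int[OF y] int[OF order.refl] sq[OF xy(1)]
  have X0: "AE \<omega> in M. X 0 \<omega> = 0" using X by (rule levy_process_0)
  \<comment> \<open>On the grid 0, \<open>x\<close>, \<open>y\<close> the increments with index 0
    and 1 are \<open>X x - X 0\<close> and \<open>X y - X x\<close>.\<close>
  define \<tau> where "\<tau> i = (if i = 0 then 0 else if i = 1 then x else y)" for i :: nat
  have "0 \<le> \<tau> 0 \<and> (\<forall>i<2. \<tau> i \<le> \<tau> (Suc i))" using xy by (simp add: \<tau>_def)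
  then have "indep_vars (\<lambda>_. borel) (\<lambda>i \<omega>. X (\<tau> (Suc i)) \<omega> - X (\<tau> i) \<omega>) {..<2}"
    using X unfolding levy_process_def by blast
  from indep_vars_mult[OF this, of 0 1]
  have ind: "integrable M (\<lambda>\<omega>. (X x \<omega> - X 0 \<omega>) * (X y \<omega> - X x \<omega>))"
    "expectation (\<lambda>\<omega>. (X x \<omega> - X 0 \<omega>) * (X y \<omega> - X x \<omega>)) =
      expectation (\<lambda>\<omega>. X x \<omega> - X 0 \<omega>) * expectation (\<lambda>\<omega>. X y \<omega> - X x \<omega>)"
    by (simp_all add: \<tau>_def)
  have *: "AE \<omega> in M. (X x \<omega> - X 0 \<omega>) * (X y \<omega> - X x \<omega>) = X x \<omega> * (X y \<omega> - X x \<omega>)"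
    using X0 by eventually_elim simp
  from ind(1) have i: "integrable M (\<lambda>\<omega>. X x \<omega> * (X y \<omega> - X x \<omega>))"
    by (subst (asm) integrable_cong_AE[OF _ _ *]) auto
  have "expectation (\<lambda>\<omega>. X x \<omega> * (X y \<omega> - X x \<omega>)) =
      expectation (\<lambda>\<omega>. (X x \<omega> - X 0 \<omega>) * (X y \<omega> - X x \<omega>))"
    using * by (intro integral_cong_AE) auto
  also have "\<dots> = expectation (\<lambda>\<omega>. X x \<omega> - X 0 \<omega>) * expectation (\<lambda>\<omega>. X y \<omega> - X x \<omega>)"
    by (rule ind(2))
  also have "expectation (X 0) = 0"
    using X0 by (intro integral_eq_zero_AE) auto
  then have "expectation (\<lambda>\<omega>. X x \<omega> - X 0 \<omega>) = expectation (X x)" by simp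
  finally have e: "expectation (\<lambda>\<omega>. X x \<omega> * (X y \<omega> - X x \<omega>)) = expectation (X x) * (expectation (X y) - expectation (X x))"
    by simp
  have eq: "(\<lambda>\<omega>. X x \<omega> * X y \<omega>) = (\<lambda>\<omega>. (X x \<omega>)\<^sup>2 + X x \<omega> * (X y \<omega> - X x \<omega>))"
    by (auto simp: power2_eq_square algebra_simps)
  show "integrable M (\<lambda>\<omega>. X x \<omega> * X y \<omega>)"
    "expectation (\<lambda>\<omega>. X x \<omega> * X y \<omega>) =
      expectation (\<lambda>\<omega>. (X x \<omega>)\<^sup>2) + expectation (X x) * (expectation (X y) - expectation (X x))"
    unfolding eq using i e by simp_all
qed

text \<open>The Levy property speaks of the real-valued embedding; the count is recovered from it by
  the floor.\<close>

lemma poisson_process_measurable: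
  assumes "poisson_process r N" "x \<ge> 0"
  shows "N x \<in> M \<rightarrow>\<^sub>M count_space UNIV"
proof -
  have "(\<lambda>\<omega>. real (N x \<omega>)) \<in> borel_measurable M"
    using assms by (auto simp: poisson_process_def intro: levy_process_measurable)
  then have "(\<lambda>\<omega>. nat \<lfloor>real (N x \<omega>)\<rfloor>) \<in> M \<rightarrow>\<^sub>M count_space UNIV" by measurable
  then show ?thesis by simp
qed

lemma poisson_process_moments:
  assumes N: "poisson_process r N" and r: "r > 0" and x: "x \<ge> 0"
  shows "integrable M (\<lambda>\<omega>. (real (N x \<omega>))\<^sup>2)"
    "expectation (\<lambda>\<omega>. real (N x \<omega>)) = r * x"
    "expectation (\<lambda>\<omega>. (real (N x \<omega>))\<^sup>2) = r * x + (r * x)\<^sup>2"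
proof -
  note [measurable] = poisson_process_measurable[OF N x]
  have "has_bochner_integral M (\<lambda>\<omega>. real (N x \<omega>)) (r * x) \<and>
      has_bochner_integral M (\<lambda>\<omega>. (real (N x \<omega>))\<^sup>2) (r * x + (r * x)\<^sup>2)"
  \<comment> \<open>The Poisson law is prescribed at positive times only; at time 0 the moments
    follow from the almost sure start at 0.\<close>
  proof (cases "x = 0")
    case True
    have N0: "AE \<omega> in M. real (N x \<omega>) = 0"
      using N True levy_process_0[of "\<lambda>t \<omega>. real (N t \<omega>)"] by (simp add: poisson_process_def)
    have "has_bochner_integral M (\<lambda>\<omega>. real (N x \<omega>)) 0"
      using N0 by (subst has_bochner_integral_cong_AE[where g="\<lambda>_. 0"]) auto
    moreover have "has_bochner_integral M (\<lambda>\<omega>. (real (N x \<omega>))\<^sup>2) 0"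
      using N0 by (subst has_bochner_integral_cong_AE[where g="\<lambda>_. 0"]) auto
    ultimately show ?thesis using True by simp
  next
    case False
    with x r have rx: "r * x > 0" and "x > 0" by simp_all
    then have d: "distr M (count_space UNIV) (N x) = measure_pmf (poisson_pmf (r * x))"
      using N by (simp add: poisson_process_def)
    have *: "has_bochner_integral M (\<lambda>\<omega>. f (N x \<omega>)) c"
      if "has_bochner_integral (measure_pmf (poisson_pmf (r * x))) f c" for f :: "nat \<Rightarrow> real" and c
      using that unfolding d[symmetric] has_bochner_integral_iff
      by (simp add: integrable_distr_eq integral_distr)
    note m = poisson_pmf_factorial_moments[OF rx]
    have "(real n)\<^sup>2 = real n + real n * (real n - 1)" for n by (simp add: power2_eq_square algebra_simps)
    then show ?thesis using *[OF m(1)] *[OF has_bochner_integral_add[OF m]] by simp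
  qed
  then show "integrable M (\<lambda>\<omega>. (real (N x \<omega>))\<^sup>2)"
    "expectation (\<lambda>\<omega>. real (N x \<omega>)) = r * x"
    "expectation (\<lambda>\<omega>. (real (N x \<omega>))\<^sup>2) = r * x + (r * x)\<^sup>2"
    by (auto simp: has_bochner_integral_iff)
qed

text \<open>By stationarity \<open>N y - N x\<close> has the law of \<open>N (y - x) - N 0\<close>,
  which is almost surely nonnegative because \<open>N 0\<close> vanishes and counts are
  nonnegative.\<close>

lemma poisson_process_mono_AE:
  assumes N: "poisson_process r N" and xy: "0 \<le> x" "x \<le> y"
  shows "AE \<omega> in M. N x \<omega> \<le> N y \<omega>"
proof -
  let ?R = "\<lambda>t \<omega>. real (N t \<omega>)"
  have L: "levy_process ?R" using N by (simp add: poisson_process_def)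
  have M: "?R t \<in> borel_measurable M" if "t \<ge> 0" for t
    using levy_process_measurable[OF L that] .
  note [measurable] = M[OF xy(1)] M[of y] M[of "y - x"] M[of 0]
  have "\<forall>s\<ge>0. \<forall>h\<ge>0. distr M borel (\<lambda>\<omega>. ?R (s + h) \<omega> - ?R s \<omega>) = distr M borel (\<lambda>\<omega>. ?R h \<omega> - ?R 0 \<omega>)"
    using L unfolding levy_process_def by blast
  from this[rule_format, of x "y - x"] xy have d: "distr M borel (\<lambda>\<omega>. ?R y \<omega> - ?R x \<omega>) = distr M borel (\<lambda>\<omega>. ?R (y - x) \<omega> - ?R 0 \<omega>)"
    by simp
  have "AE \<omega> in M. 0 \<le> ?R (y - x) \<omega> - ?R 0 \<omega>"
    using levy_process_0[OF L] by eventually_elim simp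
  then have "AE z in distr M borel (\<lambda>\<omega>. ?R (y - x) \<omega> - ?R 0 \<omega>). 0 \<le> z"
    using xy by (subst AE_distr_iff) auto
  then have "AE \<omega> in M. 0 \<le> ?R y \<omega> - ?R x \<omega>"
    unfolding d[symmetric] using xy by (subst (asm) AE_distr_iff) auto
  then show ?thesis by eventually_elim simp
qed

lemma poisson_process_product:
  assumes N: "poisson_process r N" and r: "r > 0" and xy: "0 \<le> x" "x \<le> y"
  shows "expectation (\<lambda>\<omega>. real (N x \<omega>) * real (N y \<omega>)) = r * x + r\<^sup>2 * (x * y)"
proof -
  have y: "y \<ge> 0" using xy by simp
  have L: "levy_process (\<lambda>t \<omega>. real (N t \<omega>))" using N by (simp add: poisson_process_def)
  show ?thesis
    by (subst levy_process_product(2)[OF L xy poisson_process_moments(1)[OF N r]])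
      (simp_all add: poisson_process_moments[OF N r] xy y, simp add: power2_eq_square algebra_simps)
qed

text \<open>Right-continuity of an integer-valued path is local constancy, since integers less than
  1 apart coincide. In this form it passes to random sums, which at a fixed sample point depend on
  time only through the count.\<close>

lemma poisson_process_eventually_const:
  assumes N: "poisson_process r N" and "\<omega> \<in> space M" "t \<ge> 0"
  shows "\<forall>\<^sub>F u in at_right t. N u \<omega> = N t \<omega>"
proof -
  have "continuous (at_right t) (\<lambda>u. real (N u \<omega>))"
    using assms by (simp add: poisson_process_def levy_process_def)
  then have "((\<lambda>u. real (N u \<omega>)) \<longlongrightarrow> real (N t \<omega>)) (at_right t)"
    by (simp add: continuous_within)
  then have "\<forall>\<^sub>F u in at_right t. dist (real (N u \<omega>)) (real (N t \<omega>)) < 1"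
    by (rule tendstoD) simp
  then show ?thesis by eventually_elim (simp add: dist_real_def)
qed

section \<open>Moments of the processes of order k\<close>

text \<open>The slope \<open>a\<close> is the Poisson rate \<open>real k * lam\<close> times the
  mean \<open>(real k + 1) / 2\<close> of the uniform law. Of the mixed moments only their shape is
  recorded, a term linear in the earlier time plus the product of the means, because a further
  random sum preserves this shape.\<close>

lemma ppok_moments:
  assumes Nk: "ppok k lam Nk" and k: "k \<ge> 1" and lam: "lam > 0"
  defines "a \<equiv> real k * (real k + 1) / 2 * lam"
  shows "x \<ge> 0 \<Longrightarrow> integrable M (\<lambda>\<omega>. (real (Nk x \<omega>))\<^sup>2)"
    "x \<ge> 0 \<Longrightarrow> expectation (\<lambda>\<omega>. real (Nk x \<omega>)) = a * x"
    "0 \<le> x \<Longrightarrow> x \<le> y \<Longrightarrow> AE \<omega> in M. Nk x \<omega> \<le> Nk y \<omega>"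
    "\<exists>b. \<forall>x y. 0 \<le> x \<longrightarrow> x \<le> y \<longrightarrow>
       expectation (\<lambda>\<omega>. real (Nk x \<omega>) * real (Nk y \<omega>)) = b * x + a\<^sup>2 * (x * y)"
    "\<omega> \<in> space M \<Longrightarrow> t \<ge> 0 \<Longrightarrow> \<forall>\<^sub>F u in at_right t. Nk u \<omega> = Nk t \<omega>"
proof -
  define r where "r = real k * lam"
  have r: "r > 0" using k lam by (simp add: r_def)
  from Nk obtain N X where N: "poisson_process r N"
    and Xi: "indep_vars (\<lambda>_. count_space UNIV) X {1..}"
    and Xd: "\<And>i. i \<ge> 1 \<Longrightarrow> distr M (count_space UNIV) (X i) = measure_pmf (pmf_of_set {1..k})"
    and ind: "indep_families {1..} (count_space UNIV) X {0..} (count_space UNIV) N"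
    and Nk_eq: "\<And>t \<omega>. t \<ge> 0 \<Longrightarrow> \<omega> \<in> space M \<Longrightarrow> Nk t \<omega> = (\<Sum>i=1..N t \<omega>. X i \<omega>)"
    unfolding ppok_def r_def by blast
  from indep_families_subalgebras[OF ind] obtain F G where
    F: "subalgebra M F" and G: "subalgebra M G" and FG: "indep_set (sets F) (sets G)"
    and XF: "\<And>i. i \<ge> 1 \<Longrightarrow> X i \<in> F \<rightarrow>\<^sub>M count_space UNIV"
    and NG: "\<And>t. t \<ge> 0 \<Longrightarrow> N t \<in> G \<rightarrow>\<^sub>M count_space UNIV"
    by (metis atLeast_iff)
  have RF: "(\<lambda>\<omega>. real (X i \<omega>)) \<in> borel_measurable F" if "i \<ge> 1" for i
    using XF[OF that] by measurable
  have XM: "X i \<in> M \<rightarrow>\<^sub>M count_space UNIV" if "i \<ge> 1" for i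
    using measurable_from_subalg[OF F XF[OF that]] .
  have ne: "{1..k} \<noteq> {}" "finite {1..k}" using k by auto
  have *: "integrable M (\<lambda>\<omega>. f (X i \<omega>)) \<and> expectation (\<lambda>\<omega>. f (X i \<omega>)) = (\<Sum>j=1..k. f j) / real k"
    if "i \<ge> 1" for i and f :: "nat \<Rightarrow> real"
  proof -
    have "integrable (measure_pmf (pmf_of_set {1..k})) f"
      using ne by (intro integrable_measure_pmf_finite) simp
    moreover have "integral\<^sup>L (measure_pmf (pmf_of_set {1..k})) f = (\<Sum>j=1..k. f j) / real k"
      using ne by (subst integral_pmf_of_set) auto
    ultimately show ?thesis
      unfolding Xd[OF that, symmetric] using XM[OF that] by (simp add: integrable_distr_eq integral_distr)
  qed
  define \<mu> where "\<mu> = (real k + 1) / 2"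
  define q where "q = (\<Sum>j=1..k. (real j)\<^sup>2) / real k"
  have "2 * (\<Sum>j=1..k. real j) = real k * (real k + 1)"
    by (induction k) (simp_all add: algebra_simps)
  then have "(\<Sum>j=1..k. real j) / real k = \<mu>"
    using k by (simp add: \<mu>_def field_simps)
  with * have X_mean: "expectation (\<lambda>\<omega>. real (X i \<omega>)) = \<mu>" if "i \<ge> 1" for i
    using that by simp
  have X_int: "integrable M (\<lambda>\<omega>. real (X i \<omega>))" "integrable M (\<lambda>\<omega>. (real (X i \<omega>))\<^sup>2)"
     "expectation (\<lambda>\<omega>. (real (X i \<omega>))\<^sup>2) = q" if "i \<ge> 1" for i
    using *[OF that, of real] *[OF that, of "\<lambda>n. (real n)\<^sup>2"] by (auto simp: q_def)
  have X_uncorr: "expectation (\<lambda>\<omega>. real (X i \<omega>) * real (X j \<omega>)) = \<mu>\<^sup>2"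
    if "i \<ge> 1" "j \<ge> 1" "i \<noteq> j" for i j
  proof -
    have "indep_vars (\<lambda>_. borel) (\<lambda>i \<omega>. real (X i \<omega>)) {1..}"
      using Xi by (rule indep_vars_compose2) simp
    from indep_vars_mult(2)[OF this, of i j] show ?thesis
      using that by (simp add: X_int X_mean power2_eq_square)
  qed
  have N_int: "integrable M (\<lambda>\<omega>. real (N x \<omega>))" if "x \<ge> 0" for x
  proof (rule square_integrable_imp_integrable)
    note [measurable] = poisson_process_measurable[OF N that]
    show "(\<lambda>\<omega>. real (N x \<omega>)) \<in> borel_measurable M" by measurable
  qed (rule poisson_process_moments(1)[OF N r that])
  have Nk_real: "real (Nk t \<omega>) = (\<Sum>i=1..N t \<omega>. real (X i \<omega>))" if "t \<ge> 0" "\<omega> \<in> space M" for t \<omega>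
    using Nk_eq[OF that] by simp
  note prod = random_sum_product[OF F G FG RF NG NG X_int(2,3) X_uncorr poisson_process_moments(1)[OF N r]
     poisson_process_moments(1)[OF N r]]
  show "integrable M (\<lambda>\<omega>. (real (Nk x \<omega>))\<^sup>2)" if x: "x \<ge> 0" for x
    by (subst Bochner_Integration.integrable_cong[OF refl])
      (auto simp: Nk_real[OF x] power2_eq_square intro: prod x simp del: One_nat_def)
  have a: "a = \<mu> * r" by (simp add: a_def \<mu>_def r_def)
  show "expectation (\<lambda>\<omega>. real (Nk x \<omega>)) = a * x" if x: "x \<ge> 0" for x
  proof -
    have "expectation (\<lambda>\<omega>. real (Nk x \<omega>)) = expectation (\<lambda>\<omega>. \<Sum>i=1..N x \<omega>. real (X i \<omega>))"
      by (intro Bochner_Integration.integral_cong refl Nk_real x)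
    \<comment> \<open>The summands are nonnegative, so \<open>\<mu>\<close> also serves as the bound
      \<open>\<nu>\<close> on their absolute mean.\<close>
    also have "\<dots> = \<mu> * expectation (\<lambda>\<omega>. real (N x \<omega>))"
      using x by (intro random_sum_mean(2)[OF F G FG RF NG, where \<nu>=\<mu>]) (auto simp: X_int X_mean N_int)
    finally show ?thesis using x by (simp add: poisson_process_moments[OF N r] a)
  qed
  show "AE \<omega> in M. Nk x \<omega> \<le> Nk y \<omega>" if "0 \<le> x" "x \<le> y" for x y
    using poisson_process_mono_AE[OF N that] AE_space
    by eventually_elim (use that in \<open>auto simp: Nk_eq intro!: sum_mono2\<close>)
  show "\<exists>b. \<forall>x y. 0 \<le> x \<longrightarrow> x \<le> y \<longrightarrow>
       expectation (\<lambda>\<omega>. real (Nk x \<omega>) * real (Nk y \<omega>)) = b * x + a\<^sup>2 * (x * y)"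
  \<comment> \<open>The witness stays schematic until the last equation fixes it: one part comes
    from the diagonal terms, the other from the linear part of the Poisson mixed moment.\<close>
  proof (intro exI allI impI)
    fix x y :: real assume xy: "0 \<le> x" "x \<le> y"
    then have y: "y \<ge> 0" by simp
    have "expectation (\<lambda>\<omega>. real (Nk x \<omega>) * real (Nk y \<omega>)) =
        expectation (\<lambda>\<omega>. (\<Sum>i=1..N x \<omega>. real (X i \<omega>)) * (\<Sum>i=1..N y \<omega>. real (X i \<omega>)))"
      by (intro Bochner_Integration.integral_cong refl) (simp only: Nk_real xy y)
    also have "\<dots> = (q - \<mu>\<^sup>2) * expectation (\<lambda>\<omega>. real (min (N x \<omega>) (N y \<omega>)))
        + \<mu>\<^sup>2 * expectation (\<lambda>\<omega>. real (N x \<omega>) * real (N y \<omega>))"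
      by (rule prod(2)) (use xy y in auto)
    \<comment> \<open>Almost sure monotonicity turns the minimum into the earlier count.\<close>
    also have "expectation (\<lambda>\<omega>. real (min (N x \<omega>) (N y \<omega>))) = expectation (\<lambda>\<omega>. real (N x \<omega>))"
      using poisson_process_measurable[OF N xy(1)] poisson_process_measurable[OF N y]
        poisson_process_mono_AE[OF N xy]
      by (intro integral_cong_AE) (auto simp: min_def)
    finally show "expectation (\<lambda>\<omega>. real (Nk x \<omega>) * real (Nk y \<omega>)) =
        ((q - \<mu>\<^sup>2) * r + \<mu>\<^sup>2 * r) * x + a\<^sup>2 * (x * y)"
      using xy by (simp add: poisson_process_moments[OF N r] poisson_process_product[OF N r] a
        power_mult_distrib algebra_simps)
  qed
  \<comment> \<open>The random-sum formula holds at nonnegative times only, hence the restriction to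
    \<open>u > t\<close>.\<close>
  show "\<forall>\<^sub>F u in at_right t. Nk u \<omega> = Nk t \<omega>" if "\<omega> \<in> space M" "t \<ge> 0" for \<omega> t
    using poisson_process_eventually_const[OF N that] eventually_at_right_less[of t]
    by eventually_elim (use that in \<open>simp add: Nk_eq\<close>)
qed

text \<open>\<open>Y\<close> merely represents \<open>H\<close>: equal distribution functions mean
  equal laws, so its moments are those of every summand. The random-sum identities are then applied
  with the process of order k as the count.\<close>

lemma cppok_moments:
  assumes Z: "cppok k lam H Z" and k: "k \<ge> 1" and lam: "lam > 0"
    and Y: "Y \<in> borel_measurable M" "cdf (distr M borel Y) = H" "integrable M Y"
  defines "a \<equiv> real k * (real k + 1) / 2 * lam"
  shows "x \<ge> 0 \<Longrightarrow> integrable M (Z x)"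
    "x \<ge> 0 \<Longrightarrow> expectation (Z x) = a * expectation Y * x"
    "x \<ge> 0 \<Longrightarrow> expectation (\<lambda>\<omega>. \<bar>Z x \<omega>\<bar>) \<le> a * expectation (\<lambda>\<omega>. \<bar>Y \<omega>\<bar>) * x"
    "integrable M (\<lambda>\<omega>. (Y \<omega>)\<^sup>2) \<Longrightarrow> \<exists>b. \<forall>x y. 0 \<le> x \<longrightarrow> x \<le> y \<longrightarrow>
       integrable M (\<lambda>\<omega>. Z x \<omega> * Z y \<omega>) \<and>
       expectation (\<lambda>\<omega>. Z x \<omega> * Z y \<omega>) = b * x + (a * expectation Y)\<^sup>2 * (x * y)"
    "\<omega> \<in> space M \<Longrightarrow> t \<ge> 0 \<Longrightarrow> \<forall>\<^sub>F u in at_right t. Z u \<omega> = Z t \<omega>"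
proof -
  from Z obtain Nk Y' where Nk: "ppok k lam Nk"
    and Yi: "indep_vars (\<lambda>_. borel) Y' {1..}"
    and Yd: "\<And>i. i \<ge> 1 \<Longrightarrow> cdf (distr M borel (Y' i)) = H"
    and ind: "indep_families {1..} borel Y' {0..} (count_space UNIV) Nk"
    and Z_eq: "\<And>t \<omega>. t \<ge> 0 \<Longrightarrow> \<omega> \<in> space M \<Longrightarrow> Z t \<omega> = (\<Sum>i=1..Nk t \<omega>. Y' i \<omega>)"
    unfolding cppok_def by blast
  from indep_families_subalgebras[OF ind] obtain F G where
    F: "subalgebra M F" and G: "subalgebra M G" and FG: "indep_set (sets F) (sets G)"
    and YF: "\<And>i. i \<ge> 1 \<Longrightarrow> Y' i \<in> borel_measurable F"
    and NG: "\<And>t. t \<ge> 0 \<Longrightarrow> Nk t \<in> G \<rightarrow>\<^sub>M count_space UNIV"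
    by (metis atLeast_iff)
  have YM: "Y' i \<in> borel_measurable M" if "i \<ge> 1" for i
    using measurable_from_subalg[OF F YF[OF that]] .
  have d: "distr M borel (Y' i) = distr M borel Y" if "i \<ge> 1" for i
    using YM[OF that] Y(1) by (intro cdf_unique real_distribution_distr) (simp_all add: Yd[OF that] Y(2))
  have *: "integrable M (\<lambda>\<omega>. f (Y' i \<omega>)) \<longleftrightarrow> integrable M (\<lambda>\<omega>. f (Y \<omega>))"
    "expectation (\<lambda>\<omega>. f (Y' i \<omega>)) = expectation (\<lambda>\<omega>. f (Y \<omega>))"
    if i: "i \<ge> 1" and f [measurable]: "f \<in> borel_measurable borel" for i and f :: "real \<Rightarrow> real"
    using integrable_distr_eq[OF YM[OF i] f] integral_distr[OF YM[OF i] f]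
      integrable_distr_eq[OF Y(1) f] integral_distr[OF Y(1) f] unfolding d[OF i] by simp_all
  have Y_int: "integrable M (Y' i)" "expectation (Y' i) = expectation Y"
     "expectation (\<lambda>\<omega>. \<bar>Y' i \<omega>\<bar>) = expectation (\<lambda>\<omega>. \<bar>Y \<omega>\<bar>)" if "i \<ge> 1" for i
    using *[OF that, of "\<lambda>x. x"] *[OF that, of abs] Y(3) by simp_all
  note N = ppok_moments[OF Nk k lam, folded a_def]
  have Nk_M: "Nk x \<in> M \<rightarrow>\<^sub>M count_space UNIV" if "x \<ge> 0" for x
    using measurable_from_subalg[OF G NG[OF that]] .
  have N_int: "integrable M (\<lambda>\<omega>. real (Nk x \<omega>))" if "x \<ge> 0" for x
  proof (rule square_integrable_imp_integrable)
    note [measurable] = Nk_M[OF that]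
    show "(\<lambda>\<omega>. real (Nk x \<omega>)) \<in> borel_measurable M" by measurable
  qed (rule N(1)[OF that])
  have mean: "integrable M (\<lambda>\<omega>. \<Sum>i=1..Nk x \<omega>. Y' i \<omega>)"
    "expectation (\<lambda>\<omega>. \<Sum>i=1..Nk x \<omega>. Y' i \<omega>) = expectation Y * expectation (\<lambda>\<omega>. real (Nk x \<omega>))"
    "expectation (\<lambda>\<omega>. \<bar>\<Sum>i=1..Nk x \<omega>. Y' i \<omega>\<bar>) \<le> expectation (\<lambda>\<omega>. \<bar>Y \<omega>\<bar>) * expectation (\<lambda>\<omega>. real (Nk x \<omega>))"
    if x: "x \<ge> 0" for x
    by (rule random_sum_mean[OF F G FG YF NG[OF x] Y_int(1,2) eq_refl[OF Y_int(3)] N_int[OF x]]; assumption)+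
  show "integrable M (Z x)" if x: "x \<ge> 0" for x
    using mean(1)[OF x] by (subst Bochner_Integration.integrable_cong[OF refl Z_eq[OF x]]) auto
  show "expectation (Z x) = a * expectation Y * x" if x: "x \<ge> 0" for x
    using mean(2)[OF x] N(2)[OF x]
    by (subst Bochner_Integration.integral_cong[OF refl Z_eq[OF x]]) (auto simp: mult_ac)
  show "expectation (\<lambda>\<omega>. \<bar>Z x \<omega>\<bar>) \<le> a * expectation (\<lambda>\<omega>. \<bar>Y \<omega>\<bar>) * x" if x: "x \<ge> 0" for x
  proof -
    have "expectation (\<lambda>\<omega>. \<bar>Z x \<omega>\<bar>) = expectation (\<lambda>\<omega>. \<bar>\<Sum>i=1..Nk x \<omega>. Y' i \<omega>\<bar>)"
      by (intro Bochner_Integration.integral_cong refl) (simp only: Z_eq[OF x])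
    with mean(3)[OF x] N(2)[OF x] show ?thesis by (simp add: mult_ac)
  qed
  show "\<exists>b. \<forall>x y. 0 \<le> x \<longrightarrow> x \<le> y \<longrightarrow>
       integrable M (\<lambda>\<omega>. Z x \<omega> * Z y \<omega>) \<and>
       expectation (\<lambda>\<omega>. Z x \<omega> * Z y \<omega>) = b * x + (a * expectation Y)\<^sup>2 * (x * y)"
    if Y2: "integrable M (\<lambda>\<omega>. (Y \<omega>)\<^sup>2)"
  proof -
    define q where "q = expectation (\<lambda>\<omega>. (Y \<omega>)\<^sup>2)"
    obtain b where b: "\<And>x y. 0 \<le> x \<Longrightarrow> x \<le> y \<Longrightarrow>
        expectation (\<lambda>\<omega>. real (Nk x \<omega>) * real (Nk y \<omega>)) = b * x + a\<^sup>2 * (x * y)"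
      using N(4) by blast
    have Y_sq: "integrable M (\<lambda>\<omega>. (Y' i \<omega>)\<^sup>2)" "expectation (\<lambda>\<omega>. (Y' i \<omega>)\<^sup>2) = q" if "i \<ge> 1" for i
      using *[OF that, of "\<lambda>x. x\<^sup>2"] Y2 by (simp_all add: q_def)
    have Y_uncorr: "expectation (\<lambda>\<omega>. Y' i \<omega> * Y' j \<omega>) = (expectation Y)\<^sup>2"
      if "i \<ge> 1" "j \<ge> 1" "i \<noteq> j" for i j
      using indep_vars_mult(2)[OF Yi, of i j] that by (simp add: Y_int power2_eq_square)
    \<comment> \<open>The new linear coefficient is the variance of \<open>Y\<close> times the mean
      slope \<open>a\<close> of the count, plus \<open>(expectation Y)\<^sup>2\<close> times the
      linear coefficient \<open>b\<close> of the count.\<close>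
    have "integrable M (\<lambda>\<omega>. Z x \<omega> * Z y \<omega>) \<and>
       expectation (\<lambda>\<omega>. Z x \<omega> * Z y \<omega>) =
         ((q - (expectation Y)\<^sup>2) * a + (expectation Y)\<^sup>2 * b) * x + (a * expectation Y)\<^sup>2 * (x * y)"
      if xy: "0 \<le> x" "x \<le> y" for x y
    proof -
      have y: "y \<ge> 0" using xy by simp
      have prod: "integrable M (\<lambda>\<omega>. (\<Sum>i=1..Nk x \<omega>. Y' i \<omega>) * (\<Sum>i=1..Nk y \<omega>. Y' i \<omega>))"
        "expectation (\<lambda>\<omega>. (\<Sum>i=1..Nk x \<omega>. Y' i \<omega>) * (\<Sum>i=1..Nk y \<omega>. Y' i \<omega>)) =
          (q - (expectation Y)\<^sup>2) * expectation (\<lambda>\<omega>. real (min (Nk x \<omega>) (Nk y \<omega>)))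
          + (expectation Y)\<^sup>2 * expectation (\<lambda>\<omega>. real (Nk x \<omega>) * real (Nk y \<omega>))"
        by (rule random_sum_product[OF F G FG YF NG[OF xy(1)] NG[OF y] Y_sq Y_uncorr N(1)[OF xy(1)] N(1)[OF y]];
          assumption)+
      have ZZ: "Z x \<omega> * Z y \<omega> = (\<Sum>i=1..Nk x \<omega>. Y' i \<omega>) * (\<Sum>i=1..Nk y \<omega>. Y' i \<omega>)"
        if "\<omega> \<in> space M" for \<omega>
        using that by (simp only: Z_eq xy y)
      have "expectation (\<lambda>\<omega>. real (min (Nk x \<omega>) (Nk y \<omega>))) = expectation (\<lambda>\<omega>. real (Nk x \<omega>))"
        using Nk_M[OF xy(1)] Nk_M[OF y] N(3)[OF xy]
        by (intro integral_cong_AE) (auto simp: min_def)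
      then have min_mean: "expectation (\<lambda>\<omega>. real (min (Nk x \<omega>) (Nk y \<omega>))) = a * x"
        using N(2)[OF xy(1)] by simp
      have "integrable M (\<lambda>\<omega>. Z x \<omega> * Z y \<omega>)"
        by (subst Bochner_Integration.integrable_cong[OF refl ZZ]) (auto intro: prod(1) simp del: One_nat_def)
      moreover have "expectation (\<lambda>\<omega>. Z x \<omega> * Z y \<omega>) =
          expectation (\<lambda>\<omega>. (\<Sum>i=1..Nk x \<omega>. Y' i \<omega>) * (\<Sum>i=1..Nk y \<omega>. Y' i \<omega>))"
        by (intro Bochner_Integration.integral_cong refl ZZ)
      ultimately show ?thesis
        using prod(2) by (simp add: min_mean b[OF xy] power_mult_distrib algebra_simps)
    qed
    then show ?thesis by blast
  qed
  show "\<forall>\<^sub>F u in at_right t. Z u \<omega> = Z t \<omega>" if "\<omega> \<in> space M" "t \<ge> 0" for \<omega> t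
    using N(5)[OF that] eventually_at_right_less[of t]
    by eventually_elim (use that in \<open>simp add: Z_eq\<close>)
qed

section \<open>Measurability of the time change\<close>

text \<open>Right-continuity makes \<open>Z\<close> a limit of processes that depend on time only through a
  countable grid.\<close>

lemma time_change_measurable:
  fixes Z :: "real \<Rightarrow> 'a \<Rightarrow> real"
  assumes Z: "\<And>u. u \<ge> 0 \<Longrightarrow> Z u \<in> borel_measurable F"
    and T: "T \<in> borel_measurable G" and T_nonneg: "\<And>\<omega>. \<omega> \<in> space G \<Longrightarrow> T \<omega> \<ge> 0"
    and right_cont: "\<And>\<omega> u. \<omega> \<in> space F \<Longrightarrow> u \<ge> 0 \<Longrightarrow> continuous (at_right u) (\<lambda>v. Z v \<omega>)"
  shows "(\<lambda>(\<omega>', \<omega>). Z (T \<omega>') \<omega>) \<in> borel_measurable (G \<Otimes>\<^sub>M F)"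
proof -
  \<comment> \<open>\<open>J n u\<close> is the cell of the grid of mesh
    \<open>1 / real (Suc n)\<close> containing \<open>u\<close>. The added 1 in
    \<open>\<tau>\<close> selects the right end of that cell, strictly beyond \<open>u\<close>, as
    an approach from the right requires.\<close>
  define \<tau> where "\<tau> n j = (real j + 1) / real (Suc n)" for n j :: nat
  define J where "J n u = nat \<lfloor>real (Suc n) * u\<rfloor>" for n :: nat and u :: real
  have "(\<lambda>p. Z (T (fst p)) (snd p)) \<in> borel_measurable (G \<Otimes>\<^sub>M F)"
  proof (rule borel_measurable_LIMSEQ_real)
    fix n
    have "(\<lambda>p. Z (\<tau> n j) (snd p)) \<in> borel_measurable (G \<Otimes>\<^sub>M F)" for j
      by (intro measurable_compose[OF measurable_snd] Z) (simp add: \<tau>_def)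
    moreover have "(\<lambda>p. J n (T (fst p))) \<in> G \<Otimes>\<^sub>M F \<rightarrow>\<^sub>M count_space UNIV"
      unfolding J_def using T by measurable
    ultimately show "(\<lambda>p. Z (\<tau> n (J n (T (fst p)))) (snd p)) \<in> borel_measurable (G \<Otimes>\<^sub>M F)"
      by (rule measurable_compose_countable)
  next
    fix p assume "p \<in> space (G \<Otimes>\<^sub>M F)"
    then have p: "fst p \<in> space G" "snd p \<in> space F" by (auto simp: space_pair_measure)
    define u where "u = T (fst p)"
    have u: "u \<ge> 0" using T_nonneg[OF p(1)] by (simp add: u_def)
    have gt: "u < \<tau> n (J n u)" and le: "\<tau> n (J n u) \<le> u + 1 / real (Suc n)" for n
    proof -
      have "real (J n u) = of_int \<lfloor>real (Suc n) * u\<rfloor>" using u by (simp add: J_def)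
      then have "real (Suc n) * u < real (J n u) + 1" "real (J n u) \<le> real (Suc n) * u"
        by linarith+
      then show "u < \<tau> n (J n u)" "\<tau> n (J n u) \<le> u + 1 / real (Suc n)"
        by (simp_all add: \<tau>_def divide_simps mult.commute)
    qed
    have "(\<lambda>n. u + 1 / real (Suc n)) \<longlonglongrightarrow> u + 0"
      by (intro tendsto_intros LIMSEQ_Suc[OF lim_1_over_n])
    then have "(\<lambda>n. \<tau> n (J n u)) \<longlonglongrightarrow> u"
      using gt le by (intro tendsto_sandwich[of "\<lambda>_. u" "\<lambda>n. \<tau> n (J n u)" sequentially "\<lambda>n. u + 1 / real (Suc n)"])
         (auto intro!: always_eventually less_imp_le)
    \<comment> \<open>Strictness in \<open>gt\<close> upgrades plain convergence to convergence
      within the right-sided filter.\<close>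
    then have "filterlim (\<lambda>n. \<tau> n (J n u)) (at_right u) sequentially"
      using gt by (auto simp: filterlim_at intro!: always_eventually less_imp_neq[symmetric])
    moreover have "((\<lambda>v. Z v (snd p)) \<longlongrightarrow> Z u (snd p)) (at_right u)"
      using right_cont[OF p(2) u] by (simp add: continuous_within)
    ultimately show "(\<lambda>n. Z (\<tau> n (J n (T (fst p)))) (snd p)) \<longlonglongrightarrow> Z (T (fst p)) (snd p)"
      unfolding u_def by (rule filterlim_compose[rotated])
  qed
  then show ?thesis by (simp add: case_prod_beta)
qed

lemma covariance_eq:
  assumes "integrable M U" "integrable M V" "integrable M (\<lambda>\<omega>. U \<omega> * V \<omega>)"
  shows "covariance U V = expectation (\<lambda>\<omega>. U \<omega> * V \<omega>) - expectation U * expectation V"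
proof -
  have "(\<lambda>\<omega>. (U \<omega> - expectation U) * (V \<omega> - expectation V)) =
      (\<lambda>\<omega>. U \<omega> * V \<omega> - expectation U * V \<omega> - expectation V * U \<omega> + expectation U * expectation V)"
    by (auto simp: algebra_simps)
  then show ?thesis
    using assms by (simp add: covariance_def prob_space algebra_simps)
qed

end

section \<open>Mean and covariance after the time change\<close>

theorem theorem3p2:
  fixes M :: "'a measure"
    and k :: nat
    and lam c1 c2 \<alpha>1 \<alpha>2 \<mu>1 \<mu>2 s t :: real
    and H :: "real \<Rightarrow> real"
    and Y :: "'a \<Rightarrow> real"
    and Z S Z1 :: "real \<Rightarrow> 'a \<Rightarrow> real"
  assumes "prob_space M"
    and "k \<ge> 1" and "lam > 0"
    and "c1 \<ge> 0" and "c2 \<ge> 0" and "c1 + c2 = 1"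
    and "\<mu>1 > 0" and "\<mu>2 > 0"
    and "\<alpha>1 \<in> {0<..<1}" and "\<alpha>2 \<in> {0<..<1}"
    and "prob_space.tcppok M k lam H c1 c2 \<alpha>1 \<alpha>2 \<mu>1 \<mu>2 Z S Z1"
    and "Y \<in> borel_measurable M" and "cdf (distr M borel Y) = H"
    and "integrable M Y"
    and "0 < s" and "s \<le> t"
  shows "(integrable M (Z1 t) \<and>
           prob_space.expectation M (Z1 t) =
             real k * (real k + 1) / 2 * lam * prob_space.expectation M Y * prob_space.expectation M (S t))
       \<and> (integrable M (\<lambda>\<omega>. (Y \<omega>)\<^sup>2) \<longrightarrow>
           integrable M (\<lambda>\<omega>. (Z 1 \<omega>)\<^sup>2) \<and>
           integrable M (\<lambda>\<omega>. (Z1 s \<omega>)\<^sup>2) \<and>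
           integrable M (\<lambda>\<omega>. (Z1 t \<omega>)\<^sup>2) \<and>
           prob_space.covariance M (Z1 s) (Z1 t) =
             (prob_space.expectation M (Z 1))\<^sup>2 * prob_space.variance M (S s)
             + prob_space.expectation M (S s) * prob_space.variance M (Z 1))"
proof -
  interpret prob_space M by fact
  define a where "a = real k * (real k + 1) / 2 * lam"
  define \<mu> where "\<mu> = expectation Y"
  have Z: "cppok k lam H Z" and S: "mtss c1 c2 \<alpha>1 \<alpha>2 \<mu>1 \<mu>2 S"
    and S_powr: "\<And>t \<rho>. t \<ge> 0 \<Longrightarrow> \<rho> > 0 \<Longrightarrow> integrable M (\<lambda>\<omega>. S t \<omega> powr \<rho>)"
    and ind: "indep_families {0..} borel Z {0..} borel S"
    and Z1: "\<And>t \<omega>. t \<ge> 0 \<Longrightarrow> \<omega> \<in> space M \<Longrightarrow> Z1 t \<omega> = Z (S t \<omega>) \<omega>"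
    using assms(11) unfolding tcppok_def by auto
  have levy: "levy_process S"
    and S_nonneg: "\<And>\<omega> t. \<omega> \<in> space M \<Longrightarrow> t \<ge> 0 \<Longrightarrow> S t \<omega> \<ge> 0"
    and S_mono: "\<And>\<omega> x y. \<omega> \<in> space M \<Longrightarrow> 0 \<le> x \<Longrightarrow> x \<le> y \<Longrightarrow> S x \<omega> \<le> S y \<omega>"
    using S unfolding mtss_def subordinator_def mono_on_def by auto
  \<comment> \<open>The moments are given as real powers; on nonnegative values the exponents 1 and
    2 give the ordinary powers.\<close>
  have S_int: "integrable M (S u)" if "u \<ge> 0" for u
    using S_powr[OF that, of 1]
    by (subst Bochner_Integration.integrable_cong[OF refl, where g="\<lambda>\<omega>. S u \<omega> powr 1"]) (auto simp: S_nonneg that)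
  have S_sq: "integrable M (\<lambda>\<omega>. (S u \<omega>)\<^sup>2)" if "u \<ge> 0" for u
    using S_powr[OF that, of 2]
    by (subst Bochner_Integration.integrable_cong[OF refl, where g="\<lambda>\<omega>. S u \<omega> powr 2"]) (auto simp: S_nonneg that)
  note m = cppok_moments[OF Z assms(2,3,12,13,14), folded a_def \<mu>_def]
  from indep_families_subalgebras[OF ind] obtain F G where
    F: "subalgebra M F" and G: "subalgebra M G" and FG: "indep_set (sets F) (sets G)"
    and ZF: "\<And>u. u \<ge> 0 \<Longrightarrow> Z u \<in> borel_measurable F"
    and SG: "\<And>u. u \<ge> 0 \<Longrightarrow> S u \<in> borel_measurable G"
    by (metis atLeast_iff)
  have space: "space F = space M" "space G = space M" using F G by (auto simp: subalgebra_def)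
  have Z_cont: "continuous (at_right u) (\<lambda>v. Z v \<omega>)" if "\<omega> \<in> space M" "u \<ge> 0" for \<omega> u
    unfolding continuous_within using m(5)[OF that] by (rule tendsto_eventually)
  have meas: "(\<lambda>(\<omega>', \<omega>). Z (S u \<omega>') \<omega>) \<in> borel_measurable (G \<Otimes>\<^sub>M F)" if "u \<ge> 0" for u
    using that by (intro time_change_measurable ZF SG) (auto simp: space S_nonneg Z_cont)
  have Z1_mean: "integrable M (Z1 u) \<and> expectation (Z1 u) = a * \<mu> * expectation (S u)" if u: "u \<ge> 0" for u
  proof -
    \<comment> \<open>With the random time frozen at \<open>x\<close>, the mean of
      \<open>Z x\<close> is \<open>a * \<mu> * x\<close>. Both this and the dominating function are
      linear in \<open>x\<close>, so the first moment of \<open>S u\<close> suffices.\<close>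
    note * = indep_set_Fubini[OF F G FG meas[OF u],
      where g="\<lambda>\<omega>. a * \<mu> * S u \<omega>" and h="\<lambda>\<omega>. a * expectation (\<lambda>\<omega>. \<bar>Y \<omega>\<bar>) * S u \<omega>",
      OF m(1)[OF S_nonneg[OF _ u]] m(3)[OF S_nonneg[OF _ u]] _ m(2)[OF S_nonneg[OF _ u]]]
    have i: "integrable M (\<lambda>\<omega>. a * expectation (\<lambda>\<omega>. \<bar>Y \<omega>\<bar>) * S u \<omega>)"
      using S_int[OF u] by simp
    have "integrable M (\<lambda>\<omega>. Z (S u \<omega>) \<omega>)" "expectation (\<lambda>\<omega>. Z (S u \<omega>) \<omega>) = a * \<mu> * expectation (S u)"
      using *[OF _ _ i] S_int[OF u] by auto
    moreover have "integrable M (Z1 u) = integrable M (\<lambda>\<omega>. Z (S u \<omega>) \<omega>)"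
      "expectation (Z1 u) = expectation (\<lambda>\<omega>. Z (S u \<omega>) \<omega>)"
      by (auto simp: Z1[OF u] intro!: Bochner_Integration.integrable_cong Bochner_Integration.integral_cong)
    ultimately show ?thesis by simp
  qed
  have t: "t \<ge> 0" and s: "s \<ge> 0" using assms(15,16) by auto
  show ?thesis
  proof (intro conjI impI)
    show "integrable M (Z1 t)" "expectation (Z1 t) = real k * (real k + 1) / 2 * lam * expectation Y * expectation (S t)"
      using Z1_mean[OF t] by (auto simp: a_def \<mu>_def)
    assume Y2: "integrable M (\<lambda>\<omega>. (Y \<omega>)\<^sup>2)"
    obtain b where ZZ: "\<And>x y. 0 \<le> x \<Longrightarrow> x \<le> y \<Longrightarrow> integrable M (\<lambda>\<omega>. Z x \<omega> * Z y \<omega>)"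
      "\<And>x y. 0 \<le> x \<Longrightarrow> x \<le> y \<Longrightarrow> expectation (\<lambda>\<omega>. Z x \<omega> * Z y \<omega>) = b * x + (a * \<mu>)\<^sup>2 * (x * y)"
      using m(4)[OF Y2] by blast
    have Z_sq: "integrable M (\<lambda>\<omega>. (Z x \<omega>)\<^sup>2)" "expectation (\<lambda>\<omega>. (Z x \<omega>)\<^sup>2) = b * x + (a * \<mu>)\<^sup>2 * x\<^sup>2"
      if "x \<ge> 0" for x
      using ZZ[OF that order.refl] by (simp_all add: power2_eq_square)
    \<comment> \<open>This bound is quadratic in the times, so after substitution of
      \<open>S\<close> it is integrable by the second moments of \<open>S\<close>.\<close>
    have ZZ_abs: "expectation (\<lambda>\<omega>. \<bar>Z x \<omega> * Z y \<omega>\<bar>) \<le>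
        (b * x + (a * \<mu>)\<^sup>2 * x\<^sup>2) + (b * y + (a * \<mu>)\<^sup>2 * y\<^sup>2)"
      if xy: "0 \<le> x" "x \<le> y" for x y
    proof -
      have y: "y \<ge> 0" using xy by simp
      have "expectation (\<lambda>\<omega>. \<bar>Z x \<omega> * Z y \<omega>\<bar>) \<le> expectation (\<lambda>\<omega>. (Z x \<omega>)\<^sup>2 + (Z y \<omega>)\<^sup>2)"
        by (intro integral_mono integrable_abs ZZ Bochner_Integration.integrable_add Z_sq xy y
          abs_mult_le_sum_power2)
      then show ?thesis using xy y by (simp add: Z_sq)
    qed
    have Z1_prod: "integrable M (\<lambda>\<omega>. Z1 x \<omega> * Z1 y \<omega>) \<and> expectation (\<lambda>\<omega>. Z1 x \<omega> * Z1 y \<omega>) =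
        b * expectation (S x) + (a * \<mu>)\<^sup>2 * expectation (\<lambda>\<omega>. S x \<omega> * S y \<omega>)"
      if xy: "0 \<le> x" "x \<le> y" for x y
    proof -
      have y: "y \<ge> 0" using xy by simp
      have meas2: "case_prod (\<lambda>\<omega>' \<omega>. Z (S x \<omega>') \<omega> * Z (S y \<omega>') \<omega>) \<in> borel_measurable (G \<Otimes>\<^sub>M F)"
        using borel_measurable_times[OF meas[OF xy(1)] meas[OF y]] by (simp add: case_prod_beta)
      \<comment> \<open>\<open>h\<close> and \<open>g\<close> are the bound and the mixed moment of
        \<open>Z\<close> evaluated at the random times. The paths of \<open>S\<close> are monotone,
        so these times are always in the order that \<open>ZZ\<close> demands.\<close>
      define h where "h \<omega> = (b * S x \<omega> + (a * \<mu>)\<^sup>2 * (S x \<omega>)\<^sup>2) + (b * S y \<omega> + (a * \<mu>)\<^sup>2 * (S y \<omega>)\<^sup>2)" for \<omega>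
      define g where "g \<omega> = b * S x \<omega> + (a * \<mu>)\<^sup>2 * (S x \<omega> * S y \<omega>)" for \<omega>
      have h: "integrable M h" unfolding h_def by (simp add: S_int S_sq xy y)
      have S_prod: "integrable M (\<lambda>\<omega>. S x \<omega> * S y \<omega>)" by (rule levy_process_product(1)[OF levy xy S_sq])
      have abs_h: "expectation (\<lambda>\<omega>. \<bar>Z (S x \<omega>') \<omega> * Z (S y \<omega>') \<omega>\<bar>) \<le> h \<omega>'" if "\<omega>' \<in> space M" for \<omega>'
        unfolding h_def by (rule ZZ_abs[OF S_nonneg[OF that xy(1)] S_mono[OF that xy]])
      have mean_g: "expectation (\<lambda>\<omega>. Z (S x \<omega>') \<omega> * Z (S y \<omega>') \<omega>) = g \<omega>'" if "\<omega>' \<in> space M" for \<omega>'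
        unfolding g_def by (rule ZZ(2)[OF S_nonneg[OF that xy(1)] S_mono[OF that xy]])
      note * = indep_set_Fubini[OF F G FG meas2 ZZ(1)[OF S_nonneg[OF _ xy(1)] S_mono[OF _ xy]] abs_h h mean_g]
      have "integrable M (\<lambda>\<omega>. Z (S x \<omega>) \<omega> * Z (S y \<omega>) \<omega>)"
        "expectation (\<lambda>\<omega>. Z (S x \<omega>) \<omega> * Z (S y \<omega>) \<omega>) = expectation g"
        using * by auto
      moreover have "expectation g = b * expectation (S x) + (a * \<mu>)\<^sup>2 * expectation (\<lambda>\<omega>. S x \<omega> * S y \<omega>)"
        unfolding g_def using S_prod S_int[OF xy(1)] by simp
      moreover have "integrable M (\<lambda>\<omega>. Z1 x \<omega> * Z1 y \<omega>) = integrable M (\<lambda>\<omega>. Z (S x \<omega>) \<omega> * Z (S y \<omega>) \<omega>)"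
        by (intro Bochner_Integration.integrable_cong refl) (simp add: Z1 xy y)
      moreover have "expectation (\<lambda>\<omega>. Z1 x \<omega> * Z1 y \<omega>) = expectation (\<lambda>\<omega>. Z (S x \<omega>) \<omega> * Z (S y \<omega>) \<omega>)"
        by (intro Bochner_Integration.integral_cong refl) (simp add: Z1 xy y)
      ultimately show ?thesis by simp
    qed
    show "integrable M (\<lambda>\<omega>. (Z 1 \<omega>)\<^sup>2)" using Z_sq(1)[of 1] by simp
    show "integrable M (\<lambda>\<omega>. (Z1 s \<omega>)\<^sup>2)" "integrable M (\<lambda>\<omega>. (Z1 t \<omega>)\<^sup>2)"
      using Z1_prod[OF s order.refl] Z1_prod[OF t order.refl] by (simp_all add: power2_eq_square)
    \<comment> \<open>At time 1 the second moment is \<open>b + (a * \<mu>)\<^sup>2\<close> and the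
      mean is \<open>a * \<mu>\<close>, which identifies the existential constant
      \<open>b\<close>.\<close>
    have var_Z: "variance (Z 1) = b"
      using variance_eq[OF m(1) Z_sq(1), of 1] by (simp add: m(2) Z_sq(2))
    have var_S: "variance (S s) = expectation (\<lambda>\<omega>. (S s \<omega>)\<^sup>2) - (expectation (S s))\<^sup>2"
      by (rule variance_eq[OF S_int[OF s] S_sq[OF s]])
    have S_prod: "expectation (\<lambda>\<omega>. S s \<omega> * S t \<omega>) =
        expectation (\<lambda>\<omega>. (S s \<omega>)\<^sup>2) + expectation (S s) * (expectation (S t) - expectation (S s))"
      by (rule levy_process_product(2)[OF levy s assms(16)]) (rule S_sq)
    have "covariance (Z1 s) (Z1 t) =
        b * expectation (S s) + (a * \<mu>)\<^sup>2 * expectation (\<lambda>\<omega>. S s \<omega> * S t \<omega>)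
        - (a * \<mu> * expectation (S s)) * (a * \<mu> * expectation (S t))"
      using Z1_mean[OF s] Z1_mean[OF t] Z1_prod[OF s assms(16)] by (simp add: covariance_eq)
    \<comment> \<open>The \<open>(a * \<mu>)\<^sup>2\<close> terms collect into a multiple of the
      covariance of \<open>S s\<close> and \<open>S t\<close>. There \<open>S_prod\<close> cancels
      the mean of \<open>S t\<close> and leaves the variance of \<open>S s\<close>.\<close>
    also have "\<dots> = (expectation (Z 1))\<^sup>2 * variance (S s) + expectation (S s) * variance (Z 1)"
      unfolding var_Z var_S S_prod
      by (simp add: m(2) power2_eq_square algebra_simps)
    finally show "covariance (Z1 s) (Z1 t) =
        (expectation (Z 1))\<^sup>2 * variance (S s) + expectation (S s) * variance (Z 1)" .
  qed
qed

end
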